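(* Let $q$ be a prime power, $p$ an odd prime, $e\ge1$ and $k\ge2$ integers, $n=p^ek$, and $\ell=(p-3)/2$. For $i=1,\dots,e$ put $K_i=p^{i-1}k$ and let $\mathcal{A}_p(K_i)\subseteq\mathcal{G}_q(pK_i,K_i)$ together with its maps $\Phi^{(K_i)}_{\mathbf h}$ be as defined in the context. Let $\mathcal{D}_1=\mathcal{A}_p(K_1)$ and, for $i=2,\dots,e$, $$\mathcal{D}_i=\{\beta\,\Phi^{(K_i)}_{\mathbf h}(U):\ \beta\in\mathbb{F}_{q^{pK_i}}^*,\ \mathbf h\in I_{K_i},\ U\in\mathcal{D}_{i-1}\}\subseteq\mathcal{G}_q(p^ik,k).$$ Then ${}_{p^e}\mathcal{C}_k:=\mathcal{D}_e$ is a multi-orbit cyclic subspace code in $\mathcal{G}_q(n,k)$ of cardinality $$\prod_{i=1}^e\frac{q^{p^{i-1}k}\,(q^{(\ell+1)p^{i-1}k}-1)\,(q^{p^ik}-1)}{q^{p^{i-1}k}-1}$$ and minimum distance $2k-2$.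
   Context: $\mathcal{G}_q(N,k)$ is the set of $k$-dimensional $\mathbb{F}_q$-subspaces of $\mathbb{F}_{q^N}$; subspace distance $d(U,V)=\dim_{\mathbb{F}_q}(U+V)-\dim_{\mathbb{F}_q}(U\cap V)$; minimum distance of a code is the least distance between distinct members. $\mathrm{Orb}_{\mathbb{F}_{q^N}^*}(V)=\{\beta V:\beta\in\mathbb{F}_{q^N}^*\}$; a multi-orbit cyclic subspace code is a union of such orbits. Level code $\mathcal{A}_p(K)$ for an odd prime $p$ and positive integer $K$: fix a primitive element $\omega$ of $\mathbb{F}_{q^K}$ and $\gamma\in\mathbb{F}_{q^{pK}}$ with $\mathbb{F}_{q^K}(\gamma)=\mathbb{F}_{q^{pK}}$; let $\ell=(p-3)/2$. For $0\le\ell_0\le\ell$, let $S_{K,\ell_0}$ be the set of tuples $\underline\alpha=(\alpha_1,\dots,\alpha_{\ell_0})\in\mathbb{F}_{q^K}^{\ell_0}$ with $\alpha_{\ell_0}\neq0$ (for $\ell_0=0$ it consists of the empty tuple), and $P_{\underline\alpha}(x)=1+\alpha_1x+\dots+\alpha_{\ell_0}x^{\ell_0}$ ($P=1$ if $\ell_0=0$). Let $I_K$ be the set of indices $\mathbf h=(\ell_0,\underline\alpha,a,j,\ell_1)$ with $0\le\ell_0\le\ell_1\le\ell$, $\underline\alpha\in S_{K,\ell_0}$, $a\in\mathbb{F}_{q^K}$, $j\in\{0,1,\dots,q-2\}$. For $\mathbf h\in I_K$ define the injective $\mathbb{F}_q$-linear map $\Phi^{(K)}_{\mathbf h}:\mathbb{F}_{q^K}\to\mathbb{F}_{q^{pK}}$,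 $\Phi^{(K)}_{\mathbf h}(u)=u\,P_{\underline\alpha}(\gamma)+\omega^j(u^q+au)\gamma^{\ell_1+1}$, and set $\mathcal{A}_p(K)=\bigcup_{\mathbf h\in I_K}\mathrm{Orb}_{\mathbb{F}_{q^{pK}}^*}(\Phi^{(K)}_{\mathbf h}(\mathbb{F}_{q^K}))\subseteq\mathcal{G}_q(pK,K)$. (The choices of $\omega,\gamma$ are made independently for each $K$.) *)

theory Defs
  imports Complex_Main "HOL-Computational_Algebra.Primes"
begin

text \<open>All fields F_{q^N} are realised as the unique subfields of one ambient finite
field of type 'a (of cardinality q^n), namely F_{q^N} = {x. x^(q^N) = x}.\<close>

definition GF :: "nat \<Rightarrow> nat \<Rightarrow> ('a::{field,finite}) set" where
  "GF q N = {x. x ^ (q ^ N) = x}"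

definition Fsubspace :: "'a::field set \<Rightarrow> 'a set \<Rightarrow> bool" where
  "Fsubspace F V \<longleftrightarrow> 0 \<in> V \<and> (\<forall>x\<in>V. \<forall>y\<in>V. x + y \<in> V) \<and> (\<forall>c\<in>F. \<forall>x\<in>V. c * x \<in> V)"

definition Fspan :: "'a::field set \<Rightarrow> 'a set \<Rightarrow> 'a set" where
  "Fspan F B = \<Inter> {W. Fsubspace F W \<and> B \<subseteq> W}"

definition Fdim :: "'a::field set \<Rightarrow> 'a set \<Rightarrow> nat" where
  "Fdim F V = (LEAST d. \<exists>B. B \<subseteq> V \<and> finite B \<and> card B = d \<and> Fspan F B = V)"

definition Grass :: "nat \<Rightarrow> nat \<Rightarrow> nat \<Rightarrow> ('a::{field,finite}) set set" where
  "Grass q N k = {V. Fsubspace (GF q 1) V \<and> V \<subseteq> GF q N \<and> Fdim (GF q 1) V = k}"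

definition ssum :: "'a::field set \<Rightarrow> 'a set \<Rightarrow> 'a set" where
  "ssum U V = {u + v | u v. u \<in> U \<and> v \<in> V}"

definition sdist :: "nat \<Rightarrow> ('a::{field,finite}) set \<Rightarrow> 'a set \<Rightarrow> nat" where
  "sdist q U V = Fdim (GF q 1) (ssum U V) - Fdim (GF q 1) (U \<inter> V)"

definition min_dist :: "nat \<Rightarrow> ('a::{field,finite}) set set \<Rightarrow> nat" where
  "min_dist q C = Min {sdist q U V | U V. U \<in> C \<and> V \<in> C \<and> U \<noteq> V}"

definition smul :: "'a::field \<Rightarrow> 'a set \<Rightarrow> 'a set" where
  "smul b V = (\<lambda>x. b * x) ` V"

definition Orb :: "nat \<Rightarrow> nat \<Rightarrow> ('a::{field,finite}) set \<Rightarrow> 'a set set" where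
  "Orb q N V = {smul b V | b. b \<in> GF q N - {0}}"

definition multi_orbit_cyclic :: "nat \<Rightarrow> nat \<Rightarrow> nat \<Rightarrow> ('a::{field,finite}) set set \<Rightarrow> bool" where
  "multi_orbit_cyclic q N k C \<longleftrightarrow> C \<subseteq> Grass q N k \<and> (\<exists>R. C = (\<Union>V\<in>R. Orb q N V))"

definition is_subfield :: "'a::field set \<Rightarrow> bool" where
  "is_subfield T \<longleftrightarrow> 0 \<in> T \<and> 1 \<in> T \<and> (\<forall>x\<in>T. \<forall>y\<in>T. x + y \<in> T \<and> x * y \<in> T)
     \<and> (\<forall>x\<in>T. - x \<in> T \<and> inverse x \<in> T)"

definition adjoin :: "'a::field set \<Rightarrow> 'a \<Rightarrow> 'a set" where
  "adjoin S g = \<Inter> {T. is_subfield T \<and> S \<subseteq> T \<and> g \<in> T}"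

definition primitive_elem :: "nat \<Rightarrow> nat \<Rightarrow> ('a::{field,finite}) \<Rightarrow> bool" where
  "primitive_elem q K w \<longleftrightarrow> w \<in> GF q K \<and> GF q K - {0} = range (\<lambda>j::nat. w ^ j)"

definition Ppoly :: "'a::field list \<Rightarrow> 'a \<Rightarrow> 'a" where
  "Ppoly al x = 1 + (\<Sum>i<length al. al ! i * x ^ (i + 1))"

definition Idx :: "nat \<Rightarrow> nat \<Rightarrow> nat \<Rightarrow> (nat \<times> ('a::{field,finite}) list \<times> 'a \<times> nat \<times> nat) set" where
  "Idx q K ell = {(l0, al, a, j, l1). l0 \<le> l1 \<and> l1 \<le> ell \<and> length al = l0 \<and> set al \<subseteq> GF q K
      \<and> (l0 > 0 \<longrightarrow> last al \<noteq> 0) \<and> a \<in> GF q K \<and> j \<le> q - 2}"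

definition Phi :: "nat \<Rightarrow> 'a::{field,finite} \<Rightarrow> 'a \<Rightarrow> (nat \<times> 'a list \<times> 'a \<times> nat \<times> nat) \<Rightarrow> 'a \<Rightarrow> 'a" where
  "Phi q w g h u = (case h of (l0, al, a, j, l1) \<Rightarrow>
      u * Ppoly al g + w ^ j * (u ^ q + a * u) * g ^ (l1 + 1))"

definition levelA :: "nat \<Rightarrow> nat \<Rightarrow> nat \<Rightarrow> 'a::{field,finite} \<Rightarrow> 'a \<Rightarrow> 'a set set" where
  "levelA q p K w g = (\<Union>h\<in>Idx q K ((p - 3) div 2). Orb q (p * K) (Phi q w g h ` GF q K))"

text \<open>Dseq m = D_(m+1); w i, g i are omega, gamma for K_i = p^(i-1) k.\<close>
primrec Dseq :: "nat \<Rightarrow> nat \<Rightarrow> nat \<Rightarrow> (nat \<Rightarrow> 'a::{field,finite}) \<Rightarrow> (nat \<Rightarrow> 'a) \<Rightarrow> nat \<Rightarrow> 'a set set" where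
  "Dseq q p k w g 0 = levelA q p k (w 1) (g 1)"
| "Dseq q p k w g (Suc m) =
     {smul b (Phi q (w (m + 2)) (g (m + 2)) h ` U) | b h U.
        b \<in> GF q (p * (p ^ (m + 1) * k)) - {0} \<and> h \<in> Idx q (p ^ (m + 1) * k) ((p - 3) div 2)
        \<and> U \<in> Dseq q p k w g m}"

end

theory Submission
  imports Defs "HOL-Number_Theory.Residues" "HOL-Computational_Algebra.Polynomial"
begin

text \<open>Let two images \<open>b \<Phi>\<^sub>h(F)\<close> and \<open>b' \<Phi>\<^sub>h'(F)\<close>, \<open>F = F\<^bsub>q^K\<^esub>\<close>, share two vectors, with preimages
  \<open>u1, u2\<close> and \<open>v1, v2\<close>. Writing \<open>\<Phi>\<^sub>h(u) = A\<^sub>u(\<gamma>)\<close> and \<open>\<Phi>\<^sub>h'(v) = B\<^sub>v(\<gamma>)\<close> with polynomials over \<open>F\<close> of degree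
  at most \<open>(p - 1) / 2\<close>, the scalars cancel in \<open>A\<^sub>u\<^sub>1 B\<^sub>v\<^sub>2 = A\<^sub>u\<^sub>2 B\<^sub>v\<^sub>1\<close>, and this holds as a polynomial identity
  because \<open>\<gamma>\<close> has degree \<open>p\<close> over \<open>F\<close>. Comparing coefficients shows that the two vectors are
  \<open>F\<^sub>q\<close>-dependent unless \<open>h = h'\<close> and \<open>b, b'\<close> are \<open>F\<^sub>q\<close>-proportional. Hence lifting a code of
  \<open>k\<close>-dimensional spaces that pairwise meet in dimension at most one gives a code with the same property,
  and \<open>(b, h, U)\<close> is determined by \<open>b \<Phi>\<^sub>h(U)\<close> up to \<open>b \<in> F\<^sub>q\<^sup>*\<close>, which yields the cardinality. Distance
  \<open>2k - 2\<close> is attained by \<open>U\<close> and \<open>(x/y) U\<close> for independent \<open>x, y \<in> U\<close>.\<close>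

section \<open>Subfields of a finite field: Frobenius map, closure and cardinality\<close>

lemma card_root_set_le:
  fixes f :: "'a::{field,finite} poly"
  assumes "f \<noteq> 0" "degree f \<le> d"
  shows "card {x. poly f x = 0} \<le> d"
  using card_poly_roots_bound[OF assms(1)] assms(2) by linarith

text \<open>For \<open>x \<noteq> 0\<close>, multiplication by \<open>x\<close> permutes the nonzero
  elements; cancelling their product from both sides leaves \<open>x ^ card S = 1\<close>.\<close>

lemma finite_field_power_card:
  fixes x :: "'a::{field,finite}"
  shows "x ^ card (UNIV :: 'a set) = x"
proof (cases "x = 0")
  case True
  then show ?thesis by (simp add: power_0_left finite_UNIV_card_ge_0)
next
  case False
  define S where "S = UNIV - {0::'a}"
  have bij: "bij_betw ((*) x) S S"
    by (rule bij_betwI[where g = "\<lambda>y. y / x"]) (use False in \<open>auto simp: S_def\<close>)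
  have "prod id S = (\<Prod>y\<in>S. x * y)"
    using prod.reindex_bij_betw[OF bij, of id] by simp
  also have "\<dots> = x ^ card S * prod id S"
    by (simp add: prod.distrib)
  finally have "prod id S * (x ^ card S - 1) = 0"
    by (simp add: algebra_simps)
  moreover have "prod id S \<noteq> 0"
    by (simp add: S_def)
  ultimately have "x ^ card S = 1" by simp
  moreover have "card (UNIV :: 'a set) = Suc (card S)"
    unfolding S_def by (rule card.remove) simp_all
  ultimately show ?thesis by simp
qed

locale finite_field_tower =
  fixes q n :: nat and ambient :: "'a::{field,finite} itself"
  assumes prime_power: "\<exists>r m. prime r \<and> m \<ge> 1 \<and> q = r ^ m"
    and card_ambient: "card (UNIV :: 'a set) = q ^ n"
    and n_pos: "n > 0"
begin

text \<open>Otherwise the simplifier turns \<open>GF q 1\<close> into \<open>GF q (Suc 0)\<close>, to which no fact about \<open>Fq\<close> applies.\<close>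
declare One_nat_def [simp del]

abbreviation Fq :: "'a set" where "Fq \<equiv> GF q 1"

lemma q_gt_1: "q > 1"
proof -
  obtain r m where "prime r" "m \<ge> 1" "q = r ^ m" using prime_power by blast
  then show ?thesis using prime_gt_1_nat[of r] one_less_power[of r m] by simp
qed

lemma dvd_n_pos: "N dvd n \<Longrightarrow> N > 0"
  using n_pos by (auto intro: Nat.gr0I)

lemma q_power_gt_1: "N > 0 \<Longrightarrow> q ^ N > 1"
  using q_gt_1 one_less_power by blast

text \<open>The characteristic divides the field order \<open>q ^ n\<close>, hence equals the prime
  \<open>r\<close> of which \<open>q\<close> is a power; so raising to \<open>q ^ N\<close> is an
  iterate of the Frobenius map.\<close>

lemma frobenius_add: "(x + y :: 'a) ^ (q ^ N) = x ^ (q ^ N) + y ^ (q ^ N)"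
proof -
  obtain r m where r: "prime r" "m \<ge> 1" "q = r ^ m"
    using prime_power by blast
  have "CHAR('a) > 0" by (rule finite_imp_CHAR_pos) simp
  then have pr: "prime CHAR('a)" by (rule prime_CHAR_semidom)
  moreover have "CHAR('a) dvd r ^ (m * n)"
    using CHAR_dvd_CARD[where 'a = 'a] card_ambient r(3) by (simp add: power_mult)
  ultimately have "CHAR('a) = r"
    using r(1) pr prime_dvd_power primes_dvd_imp_eq by blast
  then show ?thesis
    using freshmans_dream'[OF pr, of "q ^ N" "m * N" x y] r(3) by (simp add: power_mult)
qed

lemma GF_0 [simp]: "(0::'a) \<in> GF q N"
  using q_gt_1 by (simp add: GF_def power_0_left)

lemma GF_1 [simp]: "(1::'a) \<in> GF q N"
  by (simp add: GF_def)

lemma GF_add: "x \<in> GF q N \<Longrightarrow> y \<in> GF q N \<Longrightarrow> x + y \<in> (GF q N :: 'a set)"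
  by (simp add: GF_def frobenius_add)

lemma GF_mult: "x \<in> GF q N \<Longrightarrow> y \<in> GF q N \<Longrightarrow> x * y \<in> (GF q N :: 'a set)"
  by (simp add: GF_def power_mult_distrib)

lemma GF_power: "x \<in> GF q N \<Longrightarrow> x ^ i \<in> (GF q N :: 'a set)"
  by (induction i) (auto intro: GF_mult)

lemma GF_inverse: "x \<in> GF q N \<Longrightarrow> inverse x \<in> (GF q N :: 'a set)"
  by (simp add: GF_def power_inverse)

lemma GF_divide: "x \<in> GF q N \<Longrightarrow> y \<in> GF q N \<Longrightarrow> x / y \<in> (GF q N :: 'a set)"
  by (simp add: divide_inverse GF_mult GF_inverse)

lemma GF_minus: "x \<in> GF q N \<Longrightarrow> - x \<in> (GF q N :: 'a set)"
  using frobenius_add[of x "- x" N] GF_0[of N]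
  by (simp add: GF_def add_eq_0_iff)

lemma GF_diff: "x \<in> GF q N \<Longrightarrow> y \<in> GF q N \<Longrightarrow> x - y \<in> (GF q N :: 'a set)"
  using GF_add[of x N "- y"] GF_minus by simp

lemma GF_sum: "(\<And>i. i \<in> A \<Longrightarrow> f i \<in> GF q N) \<Longrightarrow> sum f A \<in> (GF q N :: 'a set)"
  by (induction A rule: infinite_finite_induct) (auto intro: GF_add)

lemmas GF_closed = GF_add GF_mult GF_power GF_divide GF_minus GF_diff

lemma GF_mono: "N dvd M \<Longrightarrow> GF q N \<subseteq> (GF q M :: 'a set)"
proof
  fix x :: 'a assume "N dvd M" and x: "x \<in> GF q N"
  then obtain c where M: "M = N * c" by blast
  have "x ^ (q ^ (N * c)) = x"
    using x by (induction c) (auto simp: GF_def power_add power_mult)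
  then show "x \<in> GF q M" by (simp add: GF_def M)
qed

lemma Fq_subset: "Fq \<subseteq> GF q N"
  by (rule GF_mono) simp

lemma GF_n: "GF q n = (UNIV :: 'a set)"
  using finite_field_power_card[where 'a = 'a] by (auto simp: GF_def card_ambient)

lemma GF_unit_power:
  assumes "x \<in> GF q N" "x \<noteq> (0::'a)"
  shows "x ^ (q ^ N - 1) = 1"
proof -
  have "x * x ^ (q ^ N - 1) = x"
    using assms(1) q_gt_1 by (simp add: GF_def flip: power_Suc)
  then show ?thesis using assms(2) by simp
qed

text \<open>The complementary factor of \<^term>\<open>x ^ (q ^ N - 1) - 1\<close> in \<^term>\<open>x ^ (q ^ n - 1) - 1\<close> has too
  few roots to leave out any root of the former.\<close>
lemma card_GF:
  assumes "N dvd n"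
  shows "card (GF q N :: 'a set) = q ^ N"
proof -
  define a where "a = q ^ N - 1"
  have a0: "a > 0" using q_power_gt_1[OF dvd_n_pos[OF assms]] by (simp add: a_def)
  obtain c where c: "n = N * c" using assms by blast
  have "[q ^ n = 1] (mod a)"
  proof -
    have "[q ^ N = 1] (mod a)"
      using a0 by (auto simp: cong_def a_def mod_if le_mod_geq)
    then show ?thesis using cong_pow[of "q ^ N" 1 a c] by (simp add: c power_mult)
  qed
  then have "a dvd q ^ n - 1"
    using q_gt_1 by (metis cong_to_1_nat)
  then obtain s where s: "q ^ n - 1 = a * s" by blast
  have s0: "s > 0" using s q_power_gt_1[OF n_pos] by (cases s) auto
  define A where "A = {x::'a. x ^ a = 1}"
  define f where "f = (\<Sum>i<s. monom (1::'a) (a * i))"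
  have "coeff f 0 = (\<Sum>i<s. if i = 0 then 1 else 0)"
    using a0 by (auto simp: f_def coeff_sum intro!: sum.cong)
  then have "f \<noteq> 0" using s0 by auto
  moreover have "degree f \<le> a * (s - 1)"
    unfolding f_def
  proof (intro degree_sum_le)
    fix i assume "i \<in> {..<s}"
    then have "a * i \<le> a * (s - 1)" by (intro mult_le_mono2) auto
    then show "degree (monom (1::'a) (a * i)) \<le> a * (s - 1)"
      using degree_monom_le order.trans by blast
  qed simp
  ultimately have "card {x. poly f x = 0} \<le> a * (s - 1)"
    by (rule card_root_set_le)
  \<comment> \<open>\<open>poly f x\<close> is the geometric sum in \<open>x ^ a\<close>, so each
    nonzero \<open>x\<close>, being a root of \<open>x ^ (a * s) - 1\<close>, is a root of one of
    the two factors.\<close>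
  moreover have "UNIV - {0} \<subseteq> A \<union> {x. poly f x = 0}"
  proof
    fix x :: 'a assume "x \<in> UNIV - {0}"
    then have "x ^ (a * s) = 1"
      using GF_unit_power[of x n] by (simp add: GF_n flip: s)
    then have "(x ^ a - 1) * (\<Sum>i<s. (x ^ a) ^ i) = 0"
      by (simp add: power_mult flip: power_diff_1_eq)
    then show "x \<in> A \<union> {x. poly f x = 0}"
      by (auto simp: A_def f_def poly_sum poly_monom power_mult)
  qed
  then have "card (UNIV - {0::'a}) \<le> card A + card {x. poly f x = 0}"
    by (meson card_Un_le card_mono finite order.trans)
  moreover have "card (UNIV - {0::'a}) = a * s"
    using s card_ambient by (simp add: card_Diff_singleton)
  moreover have "a * s = a + a * (s - 1)" using s0 by (cases s) auto
  ultimately have "a \<le> card A" by linarith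
  moreover have "card A \<le> a"
  proof -
    let ?f = "monom 1 a - 1 :: 'a poly"
    have "coeff ?f a = 1" using a0 by simp
    then have "?f \<noteq> 0" by (metis coeff_0 zero_neq_one)
    then have "card {x. poly ?f x = 0} \<le> a"
      by (rule card_root_set_le) (auto intro: degree_diff_le degree_monom_le)
    then show ?thesis by (simp add: A_def poly_monom)
  qed
  ultimately have "card A = a" by simp
  moreover have "GF q N = insert 0 A"
  proof -
    have "x ^ (q ^ N) = x * x ^ a" for x :: 'a
      using q_gt_1 by (simp add: a_def flip: power_Suc)
    then show ?thesis by (auto simp: GF_def A_def)
  qed
  moreover have "0 \<notin> A" using a0 by (simp add: A_def power_0_left)
  ultimately show ?thesis using a0 by (simp add: a_def)
qed

lemma card_Fq: "card Fq = q"
  using card_GF[of 1] by simp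

lemma GF_unit_subgroup_power:
  assumes "x ^ (q - 1) = (1::'a)"
  shows "x \<in> Fq"
proof -
  have "x ^ Suc (q - 1) = x" using assms by simp
  then show ?thesis using q_gt_1 by (simp add: GF_def)
qed

end

section \<open>Linear algebra over \<open>Fq\<close> by counting vectors\<close>

lemma card_eq_card_image_times_fiber:
  assumes "finite A" "\<And>x. x \<in> A \<Longrightarrow> card {x' \<in> A. f x' = f x} = m"
  shows "card A = card (f ` A) * m"
proof -
  have "card A = (\<Sum>y\<in>f ` A. card {x' \<in> A. f x' = y})"
    using sum.image_gen[OF assms(1), of "\<lambda>_. 1::nat" f] by simp
  also have "\<dots> = (\<Sum>y\<in>f ` A. m)"
    using assms(2) by (intro sum.cong) auto
  finally show ?thesis by simp
qed

lemma Fsubspace_zero: "Fsubspace F V \<Longrightarrow> 0 \<in> V"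
  by (simp add: Fsubspace_def)

lemma Fsubspace_Int: "Fsubspace F U \<Longrightarrow> Fsubspace F V \<Longrightarrow> Fsubspace F (U \<inter> V)"
  by (auto simp: Fsubspace_def)

lemma Fsubspace_ssum:
  assumes "Fsubspace F U" "Fsubspace F V"
  shows "Fsubspace F (ssum U V)"
  unfolding Fsubspace_def
proof (intro conjI ballI)
  show "0 \<in> ssum U V"
    unfolding ssum_def using assms by (intro CollectI exI[of _ 0]) (auto simp: Fsubspace_def)
next
  fix x y assume "x \<in> ssum U V" "y \<in> ssum U V"
  then obtain u v u' v' where "u \<in> U" "v \<in> V" "u' \<in> U" "v' \<in> V" "x = u + v" "y = u' + v'"
    by (auto simp: ssum_def)
  then show "x + y \<in> ssum U V"
    unfolding ssum_def using assms
    by (intro CollectI exI[of _ "u + u'"] exI[of _ "v + v'"]) (auto simp: Fsubspace_def)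
next
  fix c x assume "c \<in> F" "x \<in> ssum U V"
  then obtain u v where "u \<in> U" "v \<in> V" "x = u + v"
    by (auto simp: ssum_def)
  then show "c * x \<in> ssum U V"
    unfolding ssum_def using assms \<open>c \<in> F\<close>
    by (intro CollectI exI[of _ "c * u"] exI[of _ "c * v"]) (auto simp: Fsubspace_def distrib_left)
qed

lemma Fsubspace_Fspan: "Fsubspace F (Fspan F B)"
  by (auto simp: Fspan_def Fsubspace_def)

lemma Fspan_superset: "B \<subseteq> Fspan F B"
  by (auto simp: Fspan_def)

lemma Fspan_least: "Fsubspace F W \<Longrightarrow> B \<subseteq> W \<Longrightarrow> Fspan F B \<subseteq> W"
  by (auto simp: Fspan_def)

context finite_field_tower
begin

lemma Fsubspace_diff: "Fsubspace Fq V \<Longrightarrow> x \<in> V \<Longrightarrow> y \<in> V \<Longrightarrow> x - y \<in> V"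
proof -
  assume *: "Fsubspace Fq V" "x \<in> V" "y \<in> V"
  then have "(- 1) * y \<in> V"
    using GF_minus[OF GF_1, of 1] unfolding Fsubspace_def by blast
  then have "x + (- 1) * y \<in> V" using * unfolding Fsubspace_def by blast
  then show "x - y \<in> V" by simp
qed

lemma Fspan_insert:
  "Fspan Fq (insert b B) = (\<lambda>(c, x). c * b + x) ` (Fq \<times> Fspan Fq B)" (is "_ = ?W")
proof
  have "Fsubspace Fq ?W"
    unfolding Fsubspace_def
  proof (intro conjI ballI)
    show "0 \<in> ?W"
      by (rule image_eqI[of _ _ "(0, 0)"]) (simp_all add: Fsubspace_zero[OF Fsubspace_Fspan])
  next
    fix x y assume "x \<in> ?W" "y \<in> ?W"
    then obtain c u d v where *: "c \<in> Fq" "u \<in> Fspan Fq B" "d \<in> Fq" "v \<in> Fspan Fq B"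
      "x = c * b + u" "y = d * b + v" by auto
    show "x + y \<in> ?W"
      using * Fsubspace_Fspan[of Fq B]
      by (intro image_eqI[of _ _ "(c + d, u + v)"])
        (auto simp: algebra_simps GF_add Fsubspace_def)
  next
    fix d x assume "d \<in> Fq" "x \<in> ?W"
    moreover from this obtain c u where *: "c \<in> Fq" "u \<in> Fspan Fq B" "x = c * b + u" by auto
    ultimately show "d * x \<in> ?W"
      using Fsubspace_Fspan[of Fq B]
      by (intro image_eqI[of _ _ "(d * c, d * u)"])
        (auto simp: algebra_simps GF_mult Fsubspace_def)
  qed
  moreover have "insert b B \<subseteq> ?W"
  proof
    fix x assume x: "x \<in> insert b B"
    show "x \<in> ?W"
    proof (cases "x = b")
      case True
      then show ?thesis
        by (intro image_eqI[of _ _ "(1, 0)"]) (simp_all add: Fsubspace_zero[OF Fsubspace_Fspan])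
    next
      case False
      then show ?thesis
        using x Fspan_superset[of B Fq] by (intro image_eqI[of _ _ "(0, x)"]) auto
    qed
  qed
  ultimately show "Fspan Fq (insert b B) \<subseteq> ?W" by (rule Fspan_least)
  have "Fspan Fq B \<subseteq> Fspan Fq (insert b B)"
    by (intro Fspan_least Fsubspace_Fspan) (use Fspan_superset[of "insert b B" Fq] in auto)
  then show "?W \<subseteq> Fspan Fq (insert b B)"
    using Fsubspace_Fspan[of Fq "insert b B"] Fspan_superset[of "insert b B" Fq]
    by (auto simp: Fsubspace_def subset_iff)
qed

lemma Fspan_empty: "Fspan Fq {} = {0}"
  using Fspan_least[of Fq "{0}" "{}"] Fsubspace_zero[OF Fsubspace_Fspan, of Fq "{}"]
  by (auto simp: Fsubspace_def)

lemma card_Fspan_le: "card (Fspan Fq B) \<le> q ^ card B"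
proof -
  have "finite B" by simp
  then show ?thesis
  proof induction
    case empty
    then show ?case by (simp add: Fspan_empty)
  next
    case (insert b B)
    have "card (Fspan Fq (insert b B)) \<le> card (Fq \<times> Fspan Fq B)"
      unfolding Fspan_insert by (rule card_image_le) simp
    also have "\<dots> \<le> q * q ^ card B"
      unfolding card_cartesian_product card_Fq by (rule mult_le_mono2) (rule insert.IH)
    finally show ?case using insert.hyps by simp
  qed
qed

text \<open>A coincidence \<open>c * b + u = d * b + v\<close> with \<open>c \<noteq> d\<close>
  could be solved for \<open>b\<close>, placing it in the span of \<open>B\<close>.\<close>

lemma card_Fspan_insert:
  assumes "b \<notin> Fspan Fq B"
  shows "card (Fspan Fq (insert b B)) = q * card (Fspan Fq B)"
proof -
  have "inj_on (\<lambda>(c, x). c * b + x) (Fq \<times> Fspan Fq B)"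
  proof (rule inj_onI, clarify)
    fix c u d v
    assume *: "c \<in> Fq" "u \<in> Fspan Fq B" "d \<in> Fq" "v \<in> Fspan Fq B" "c * b + u = d * b + v"
    have "c = d"
    proof (rule ccontr)
      assume "c \<noteq> d"
      have "(c - d) * b = v - u" using *(5) by (simp add: algebra_simps)
      then have "b = inverse (c - d) * (v - u)" using \<open>c \<noteq> d\<close> by (simp add: field_simps)
      moreover have "inverse (c - d) \<in> Fq" using * by (intro GF_inverse GF_diff)
      moreover have "v - u \<in> Fspan Fq B" using * Fsubspace_diff[OF Fsubspace_Fspan] by blast
      ultimately have "b \<in> Fspan Fq B" using Fsubspace_Fspan[of Fq B] unfolding Fsubspace_def by blast
      with assms show False ..
    qed
    with * show "c = d \<and> u = v" by simp
  qed
  then show ?thesis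
    unfolding Fspan_insert by (simp add: card_image card_cartesian_product card_Fq)
qed

text \<open>Independence of \<open>B\<close> is expressed by its span having the full size
  \<open>q ^ card B\<close>. A maximal such subset of \<open>V\<close> spans \<open>V\<close>, since
  a vector outside the span could be added.\<close>

lemma Fsubspace_basis:
  assumes "Fsubspace Fq V"
  obtains B where "B \<subseteq> V" "Fspan Fq B = V" "card V = q ^ card B"
proof -
  define \<B> where "\<B> = {B. B \<subseteq> V \<and> card (Fspan Fq B) = q ^ card B}"
  have "{} \<in> \<B>" by (simp add: \<B>_def Fspan_empty)
  then obtain B where B: "B \<in> \<B>" and max: "\<And>B'. B' \<in> \<B> \<Longrightarrow> B \<subseteq> B' \<Longrightarrow> B = B'"
    using finite_has_maximal[of \<B>] by auto
  have "V \<subseteq> Fspan Fq B"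
  proof
    fix b assume "b \<in> V"
    show "b \<in> Fspan Fq B"
    proof (rule ccontr)
      assume b: "b \<notin> Fspan Fq B"
      then have "b \<notin> B" using Fspan_superset by blast
      then have "insert b B \<in> \<B>"
        using card_Fspan_insert[OF b] B \<open>b \<in> V\<close> by (simp add: \<B>_def)
      then show False using max \<open>b \<notin> B\<close> by blast
    qed
  qed
  then have "Fspan Fq B = V"
    using Fspan_least[OF assms] B by (auto simp: \<B>_def)
  then show thesis using that B by (auto simp: \<B>_def)
qed

text \<open>\<open>d\<close> vectors span at most \<open>q ^ d\<close> elements, so the basis found
  by counting is a smallest spanning set. From here on dimensions are read off from
  cardinalities.\<close>

lemma card_Fsubspace:
  assumes "Fsubspace Fq V"
  shows "card V = q ^ Fdim Fq V"
proof -
  obtain B where B: "B \<subseteq> V" "Fspan Fq B = V" "card V = q ^ card B"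
    using Fsubspace_basis[OF assms] .
  have "Fdim Fq V = card B"
    unfolding Fdim_def
  proof (rule Least_equality)
    show "\<exists>B'\<subseteq>V. finite B' \<and> card B' = card B \<and> Fspan Fq B' = V"
      using B by auto
  next
    fix d assume "\<exists>B'\<subseteq>V. finite B' \<and> card B' = d \<and> Fspan Fq B' = V"
    then obtain B' where "card B' = d" "Fspan Fq B' = V" by blast
    then have "q ^ card B \<le> q ^ d" using card_Fspan_le[of B'] B(3) by simp
    then show "card B \<le> d" using q_gt_1 by (simp add: power_increasing_iff)
  qed
  then show ?thesis using B by simp
qed

lemma Fdim_eqI: "Fsubspace Fq V \<Longrightarrow> card V = q ^ d \<Longrightarrow> Fdim Fq V = d"
  using card_Fsubspace[of V] q_gt_1 by simp

text \<open>The fibre of addition on \<open>U \<times> V\<close> through \<open>(u, v)\<close>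
  consists of the pairs \<open>(u + x, v - x)\<close> with \<open>x\<close> in
  \<open>U \<inter> V\<close>.\<close>

lemma card_ssum:
  assumes "Fsubspace Fq U" "Fsubspace Fq V"
  shows "card (ssum U V) * card (U \<inter> V) = card U * card V"
proof -
  have "card (U \<times> V) = card ((\<lambda>(u, v). u + v) ` (U \<times> V)) * card (U \<inter> V)"
  proof (rule card_eq_card_image_times_fiber)
    fix z assume "z \<in> U \<times> V"
    then obtain u v where z: "z = (u, v)" "u \<in> U" "v \<in> V" by auto
    let ?A = "{z' \<in> U \<times> V. (\<lambda>(u, v). u + v) z' = (\<lambda>(u, v). u + v) z}"
    have A: "?A = {(u', v'). u' \<in> U \<and> v' \<in> V \<and> u' + v' = u + v}"
      by (auto simp: z)
    have "bij_betw (\<lambda>x. (u + x, v - x)) (U \<inter> V) ?A"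
      unfolding A
    proof (rule bij_betwI[where g = "\<lambda>(u', v'). u' - u"])
      show "(\<lambda>x. (u + x, v - x)) \<in> U \<inter> V \<rightarrow> {(u', v'). u' \<in> U \<and> v' \<in> V \<and> u' + v' = u + v}"
        using z assms(1) Fsubspace_diff[OF assms(2)] by (auto simp: Fsubspace_def)
      have "u' - u \<in> U \<and> u' - u \<in> V" if "u' \<in> U" "v' \<in> V" "u' + v' = u + v" for u' v'
      proof -
        have "u' - u = v - v'" using that by (simp add: algebra_simps)
        then show ?thesis
          using that z Fsubspace_diff[OF assms(1), of u' u] Fsubspace_diff[OF assms(2), of v v']
          by simp
      qed
      then show "(\<lambda>(u', v'). u' - u) \<in> {(u', v'). u' \<in> U \<and> v' \<in> V \<and> u' + v' = u + v} \<rightarrow> U \<inter> V"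
        by auto
    next
      fix z' assume "z' \<in> {(u', v'). u' \<in> U \<and> v' \<in> V \<and> u' + v' = u + v}"
      then obtain u' v' where z': "z' = (u', v')" "u' + v' = u + v" by blast
      have "v - (u' - u) = (u + v) - u'" by simp
      also have "\<dots> = v'" by (simp flip: z'(2))
      finally show "(\<lambda>x. (u + x, v - x)) ((\<lambda>(u', v'). u' - u) z') = z'" by (simp add: z'(1))
    qed simp
    from bij_betw_same_card[OF this] show "card ?A = card (U \<inter> V)" ..
  qed simp
  moreover have "(\<lambda>(u, v). u + v) ` (U \<times> V) = ssum U V"
    by (auto simp: ssum_def)
  ultimately show ?thesis by (simp add: card_cartesian_product)
qed

lemma sdist_eq:
  assumes "Fsubspace Fq U" "Fsubspace Fq V"
  shows "sdist q U V = Fdim Fq U + Fdim Fq V - 2 * Fdim Fq (U \<inter> V)"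
proof -
  have "q ^ (Fdim Fq (ssum U V) + Fdim Fq (U \<inter> V)) = q ^ (Fdim Fq U + Fdim Fq V)"
    using card_ssum[OF assms] assms
    by (simp add: card_Fsubspace Fsubspace_ssum Fsubspace_Int power_add)
  then have "Fdim Fq (ssum U V) + Fdim Fq (U \<inter> V) = Fdim Fq U + Fdim Fq V"
    using q_gt_1 by simp
  then show ?thesis unfolding sdist_def by linarith
qed

end

section \<open>Polynomials over a subfield and the cross-product identity\<close>

definition poly_over :: "'a::zero set \<Rightarrow> 'a poly \<Rightarrow> bool" where
  "poly_over F f \<longleftrightarrow> (\<forall>i. coeff f i \<in> F)"

lemma poly_Poly:
  fixes x :: "'a::comm_ring_1"
  shows "poly (Poly xs) x = (\<Sum>i<length xs. xs ! i * x ^ i)"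
  by (induction xs) (simp_all add: sum.lessThan_Suc_shift sum_distrib_left algebra_simps
      del: sum.lessThan_Suc)

text \<open>The leading entry 1 rules out a trailing zero even for the empty tail, so
  \<open>1 # xs\<close> is already the coefficient list of its polynomial.\<close>

lemma Poly_one_Cons_eqD:
  assumes "Poly (1 # xs) = Poly (1 # ys :: 'a::field list)"
    and "xs \<noteq> [] \<Longrightarrow> last xs \<noteq> 0" "ys \<noteq> [] \<Longrightarrow> last ys \<noteq> 0"
  shows "xs = ys"
proof -
  have "strip_while ((=) 0) (1 # zs) = 1 # zs" if "zs \<noteq> [] \<Longrightarrow> last zs \<noteq> 0" for zs :: "'a list"
    using that by (intro strip_while_idem) (simp add: no_trailing_unfold)
  then have "coeffs (Poly (1 # xs)) = 1 # xs" "coeffs (Poly (1 # ys)) = 1 # ys"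
    unfolding coeffs_Poly using assms(2,3) by blast+
  then have "1 # xs = 1 # ys" unfolding assms(1) by (rule trans[OF sym])
  then show ?thesis by simp
qed

text \<open>\<open>P * Q\<close> cancels. If \<open>m \<noteq> n\<close>, the coefficient at the
  smaller of the two gives \<open>c1 = c2\<close> or \<open>d1 = d2\<close>. If
  \<open>m = n\<close>, the coefficient at \<open>m\<close> gives \<open>c1 - c2 = d1 - d2\<close>;
  when this is nonzero, the coefficients from \<open>m\<close> to \<open>2 * m - 1\<close> give
  \<open>P = Q\<close>, and the one at \<open>2 * m\<close> gives \<open>c1 = d1\<close>.\<close>

lemma poly_cross_identity:
  fixes P Q :: "'a::field poly"
  assumes deg: "degree P < m" "degree Q < n" and one: "coeff P 0 = 1" "coeff Q 0 = 1"
    and eq: "(P + monom c1 m) * (Q + monom d2 n) = (P + monom c2 m) * (Q + monom d1 n)"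
  shows "c1 = c2 \<or> d1 = d2 \<or> (m = n \<and> P = Q \<and> c1 = d1 \<and> c2 = d2)"
proof -
  have "monom (c1 - c2) m * Q + monom (d2 - d1) n * P + monom (c1 * d2 - c2 * d1) (m + n) = 0"
    using eq by (simp add: diff_monom[symmetric] mult_monom[symmetric] algebra_simps)
  then have "coeff (monom (c1 - c2) m * Q + monom (d2 - d1) n * P
      + monom (c1 * d2 - c2 * d1) (m + n)) i = 0" for i
    by simp
  then have E: "(if i < m then 0 else (c1 - c2) * coeff Q (i - m))
      + (if i < n then 0 else (d2 - d1) * coeff P (i - n))
      + (if m + n = i then c1 * d2 - c2 * d1 else 0) = 0" for i
    by (simp add: coeff_monom_mult)
  consider "m < n" | "n < m" | "m = n" "c1 = c2" | "m = n" "c1 \<noteq> c2" by linarith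
  then show ?thesis
  proof cases
    case 1
    then show ?thesis using E[of m] deg one by simp
  next
    case 2
    then show ?thesis using E[of n] deg one by simp
  next
    case 4
    have d: "d1 - d2 = c1 - c2" using E[of m] 4 deg one by (simp add: algebra_simps)
    have "coeff P i = coeff Q i" for i
    proof (cases "i < m")
      case True
      then have "(c1 - c2) * coeff Q i + (d2 - d1) * coeff P i = 0" using E[of "m + i"] 4 by simp
      moreover have d': "d2 - d1 = - (c1 - c2)" by (simp flip: d)
      ultimately have "(c1 - c2) * (coeff Q i - coeff P i) = 0"
        unfolding d' by (simp add: algebra_simps)
      then show ?thesis using 4 by simp
    next
      case False
      then show ?thesis using deg 4 by (simp add: coeff_eq_0)
    qed
    moreover have "c1 = d1 \<and> c2 = d2"
    proof -
      have "c1 * d2 - c2 * d1 = 0" using E[of "m + m"] 4 deg by (simp add: coeff_eq_0)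
      moreover have "d2 = d1 - (c1 - c2)" using d by (simp add: algebra_simps)
      ultimately have "(c1 - c2) * (d1 - c1) = 0" by (simp add: algebra_simps)
      then show ?thesis using 4 d by simp
    qed
    ultimately show ?thesis using 4 by (auto intro: poly_eqI)
  qed simp
qed

context finite_field_tower
begin

lemma poly_over_closed:
  fixes f h :: "'a poly"
  assumes "poly_over (GF q N) f" "poly_over (GF q N) h"
  shows "poly_over (GF q N) (f + h)" "poly_over (GF q N) (f - h)" "poly_over (GF q N) (f * h)"
  using assms by (auto simp: poly_over_def coeff_mult intro!: GF_closed GF_sum)

lemma poly_over_smult: "c \<in> GF q N \<Longrightarrow> poly_over (GF q N) f \<Longrightarrow> poly_over (GF q N) (smult c f :: 'a poly)"
  by (auto simp: poly_over_def intro: GF_mult)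

lemma poly_over_monom: "c \<in> GF q N \<Longrightarrow> poly_over (GF q N) (monom c i :: 'a poly)"
  by (auto simp: poly_over_def)

text \<open>Closure under inverses follows from closure under products: in the finite ambient field
  the inverse of \<open>x \<noteq> 0\<close> is the power \<open>x ^ (q ^ n - 2)\<close>.\<close>

lemma is_subfieldI:
  fixes S :: "'a set"
  assumes "0 \<in> S" "1 \<in> S" "\<And>x y. x \<in> S \<Longrightarrow> y \<in> S \<Longrightarrow> x + y \<in> S"
    "\<And>x y. x \<in> S \<Longrightarrow> y \<in> S \<Longrightarrow> x * y \<in> S" "\<And>x. x \<in> S \<Longrightarrow> - x \<in> S"
  shows "is_subfield S"
proof -
  have pow: "x ^ i \<in> S" if "x \<in> S" for x i
    by (induction i) (use assms(2,4) that in auto)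
  have "inverse x \<in> S" if "x \<in> S" for x
  proof (cases "x = 0")
    case False
    have "Suc (q ^ n - 2) = q ^ n - 1" using q_power_gt_1[OF n_pos] by linarith
    then have "x * x ^ (q ^ n - 2) = 1"
      using GF_unit_power[of x n] False by (simp add: GF_n flip: power_Suc)
    then have "inverse x = x ^ (q ^ n - 2)" by (rule inverse_unique)
    then show ?thesis using pow[OF that] by simp
  qed (use assms(1) in simp)
  then show ?thesis using assms by (simp add: is_subfield_def)
qed

text \<open>If \<^term>\<open>g\<close> were a root of a polynomial of degree \<open>d < p\<close>, then the \<open>d\<close> first powers of \<open>g\<close>
  would already span a field containing \<open>g\<close>.\<close>
lemma poly_over_root_eq_0:
  fixes f :: "'a poly" and g :: 'a
  assumes "p * K dvd n" and adj: "adjoin (GF q K) g = GF q (p * K)"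
    and f: "poly_over (GF q K) f" "degree f < p" "poly f g = 0"
  shows "f = 0"
proof (rule ccontr)
  assume "f \<noteq> 0"
  let ?F = "GF q K :: 'a set"
  have K: "K dvd n" using assms(1) by (rule dvd_mult_right)
  define d where "d = degree f"
  define a where "a = lead_coeff f"
  define S where "S = {\<Sum>i<d. c i * g ^ i | c. \<forall>i. c i \<in> ?F}"
  have a: "a \<noteq> 0" "a \<in> ?F" using \<open>f \<noteq> 0\<close> f(1) by (auto simp: a_def poly_over_def)
  have d: "d > 0"
  proof (rule Nat.gr0I)
    assume "d = 0"
    then obtain b where "f = [:b:]" by (auto simp: d_def elim: degree_eq_zeroE)
    then show False using f(3) \<open>f \<noteq> 0\<close> by simp
  qed
  have SI: "(\<Sum>i<d. c i * g ^ i) \<in> S" if "\<And>i. c i \<in> ?F" for c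
    using that by (auto simp: S_def)
  have S_add: "x + y \<in> S" if xy: "x \<in> S" "y \<in> S" for x y
  proof -
    obtain b c where "\<forall>i. b i \<in> ?F" "\<forall>i. c i \<in> ?F"
      "x = (\<Sum>i<d. b i * g ^ i)" "y = (\<Sum>i<d. c i * g ^ i)"
      using xy by (auto simp: S_def)
    then show ?thesis
      using SI[of "\<lambda>i. b i + c i"] by (simp add: GF_add sum.distrib algebra_simps)
  qed
  have S_scale: "b * x \<in> S" if bx: "b \<in> ?F" "x \<in> S" for b x
  proof -
    obtain c where "\<forall>i. c i \<in> ?F" "x = (\<Sum>i<d. c i * g ^ i)"
      using bx by (auto simp: S_def)
    then show ?thesis
      using SI[of "\<lambda>i. b * c i"] bx by (simp add: GF_mult sum_distrib_left algebra_simps)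
  qed
  have S_0: "0 \<in> S" using SI[of "\<lambda>_. 0"] by simp
  have S_F: "b \<in> S" if "b \<in> ?F" for b
  proof -
    have "(\<Sum>i<d. (if i = 0 then b else 0) * g ^ i) = (\<Sum>i<d. if i = 0 then b else 0)"
      by (rule sum.cong) auto
    also have "\<dots> = b" using d by simp
    finally show ?thesis using SI[of "\<lambda>i. if i = 0 then b else 0"] that by simp
  qed
  \<comment> \<open>Solve \<open>poly f g = 0\<close> for the leading term; the leading coefficient
    is invertible in \<open>?F\<close>.\<close>
  have S_gd: "g ^ d \<in> S"
  proof -
    have "(\<Sum>i<d. coeff f i * g ^ i) + a * g ^ d = 0"
      using f(3) by (simp add: poly_altdef d_def a_def flip: lessThan_Suc_atMost)
    then have "a * g ^ d = - (\<Sum>i<d. coeff f i * g ^ i)"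
      by (simp add: add_eq_0_iff2)
    then have "g ^ d = - inverse a * (\<Sum>i<d. coeff f i * g ^ i)"
      using a(1) by (simp add: field_simps)
    also have "\<dots> \<in> S"
      using f(1) a(2) by (intro S_scale SI) (auto simp: poly_over_def intro: GF_minus GF_inverse)
    finally show ?thesis .
  qed
  have S_g: "g * x \<in> S" if x: "x \<in> S" for x
  proof -
    obtain c where c: "\<forall>i. c i \<in> ?F" "x = (\<Sum>i<d. c i * g ^ i)"
      using x by (auto simp: S_def)
    obtain d' where d': "d = Suc d'" using d by (cases d) auto
    \<comment> \<open>Multiplying by \<open>g\<close> shifts the coefficients up by one place; the
      overflowing power \<open>g ^ d\<close> is reduced by \<open>S_gd\<close>.\<close>
    define c' where "c' i = (case i of 0 \<Rightarrow> 0 | Suc j \<Rightarrow> c j)" for i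
    have "g * x = (\<Sum>i<d'. c i * g ^ Suc i) + c d' * g ^ d"
      by (simp add: c(2) d' sum_distrib_left algebra_simps)
    also have "(\<Sum>i<d'. c i * g ^ Suc i) = (\<Sum>i<d. c' i * g ^ i)"
      by (simp add: d' c'_def sum.lessThan_Suc_shift del: sum.lessThan_Suc)
    also have "\<dots> + c d' * g ^ d \<in> S"
      using c(1) S_gd by (intro S_add SI S_scale) (auto simp: c'_def split: nat.split)
    finally show ?thesis .
  qed
  have S_mult: "x * y \<in> S" if xy: "x \<in> S" "y \<in> S" for x y
  proof -
    obtain c where c: "\<forall>i. c i \<in> ?F" "x = (\<Sum>i<d. c i * g ^ i)"
      using xy by (auto simp: S_def)
    have gy: "g ^ i * y \<in> S" for i
      by (induction i) (use xy S_g in \<open>auto simp: mult.assoc\<close>)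
    have "(\<Sum>i<m. c i * (g ^ i * y)) \<in> S" for m
      by (induction m) (use S_0 S_add S_scale gy c(1) in auto)
    then show ?thesis by (simp add: c(2) sum_distrib_right mult.assoc)
  qed
  have "- x \<in> S" if "x \<in> S" for x
    using S_scale[OF GF_minus[OF GF_1] that] by simp
  then have "is_subfield S"
    using S_0 S_F[OF GF_1] S_add S_mult by (intro is_subfieldI) auto
  moreover have "?F \<subseteq> S" using S_F by blast
  moreover have "g \<in> S" using S_g[OF S_F[OF GF_1]] by simp
  ultimately have "GF q (p * K) \<subseteq> S"
    unfolding adj[symmetric] adjoin_def by blast
  \<comment> \<open>An element of \<open>S\<close> is given by \<open>d\<close> coefficients, so the
    field of size \<open>q ^ (p * K)\<close> inside \<open>S\<close> would have at most
    \<open>q ^ (d * K)\<close> elements, against \<open>d < p\<close>.\<close>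
  moreover have "S \<subseteq> (\<lambda>cs. \<Sum>i<d. cs ! i * g ^ i) ` {cs. set cs \<subseteq> ?F \<and> length cs = d}"
  proof
    fix x assume "x \<in> S"
    then obtain c where c: "\<forall>i. c i \<in> ?F" "x = (\<Sum>i<d. c i * g ^ i)"
      by (auto simp: S_def)
    then show "x \<in> (\<lambda>cs. \<Sum>i<d. cs ! i * g ^ i) ` {cs. set cs \<subseteq> ?F \<and> length cs = d}"
      by (intro image_eqI[of _ _ "map c [0..<d]"]) auto
  qed
  ultimately have "card (GF q (p * K) :: 'a set)
      \<le> card ((\<lambda>cs. \<Sum>i<d. cs ! i * g ^ i) ` {cs. set cs \<subseteq> ?F \<and> length cs = d})"
    by (intro card_mono) auto
  also have "\<dots> \<le> card {cs. set cs \<subseteq> ?F \<and> length cs = d}"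
    by (intro card_image_le finite_lists_length_eq) simp
  also have "\<dots> = q ^ (d * K)"
    by (simp add: card_lists_length_eq card_GF[OF K] mult.commute flip: power_mult)
  finally have "p * K \<le> d * K"
    using q_gt_1 by (simp add: card_GF[OF assms(1)])
  then show False using f(2) dvd_n_pos[OF K] by (simp add: d_def)
qed

section \<open>Primitive elements and classes modulo \<open>(q - 1)\<close>-st powers\<close>

lemma primitive_elem_power_neq_1:
  fixes w :: 'a
  assumes "K dvd n" "primitive_elem q K w" "0 < d" "d < q ^ K - 1"
  shows "w ^ d \<noteq> 1"
proof
  assume "w ^ d = 1"
  \<comment> \<open>Exponents may be reduced modulo \<open>d\<close>, so \<open>d\<close> powers
    would have to cover all \<open>q ^ K - 1\<close> nonzero elements.\<close>
  have "GF q K - {0} \<subseteq> (\<lambda>j. w ^ j) ` {..<d}"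
  proof
    fix x :: 'a assume "x \<in> GF q K - {0}"
    then obtain j where "x = w ^ j" using assms(2) by (auto simp: primitive_elem_def)
    also have "w ^ j = (w ^ d) ^ (j div d) * w ^ (j mod d)"
      by (simp flip: power_mult power_add)
    finally show "x \<in> (\<lambda>j. w ^ j) ` {..<d}"
      using assms(3) \<open>w ^ d = 1\<close> by (intro image_eqI[of _ _ "j mod d"]) auto
  qed
  then have "card (GF q K - {0::'a}) \<le> card ((\<lambda>j. w ^ j) ` {..<d})"
    by (intro card_mono) auto
  also have "\<dots> \<le> d" using card_image_le[of "{..<d}" "\<lambda>j. w ^ j"] by simp
  finally show False using assms(4) by (simp add: card_GF[OF assms(1)] card_Diff_singleton)
qed

lemma primitive_elem_nonzero:
  fixes w :: 'a
  assumes "primitive_elem q K w"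
  shows "w \<noteq> 0"
proof
  assume "w = 0"
  have "w ^ 1 \<in> range (\<lambda>j. w ^ j)" by (rule rangeI)
  then show False using assms \<open>w = 0\<close> by (simp add: primitive_elem_def) (metis DiffD2 insertI1)
qed

text \<open>The powers \<open>w ^ j\<close> with \<open>j \<le> q - 2\<close> represent distinct
  cosets of the \<open>(q - 1)\<close>-st powers: raising to
  \<open>M = (q ^ K - 1) / (q - 1)\<close> sends each such power to 1, whereas
  \<open>w ^ ((j' - j) * M)\<close> differs from 1 for \<open>j < j'\<close>.\<close>

lemma primitive_elem_power_class:
  fixes w x y :: 'a
  assumes K: "K dvd n" and w: "primitive_elem q K w"
    and xy: "x \<in> GF q K" "x \<noteq> 0" "y \<in> GF q K" "y \<noteq> 0"
    and eq: "w ^ j * x ^ (q - 1) = w ^ j' * y ^ (q - 1)" and j: "j \<le> q - 2" "j' \<le> q - 2"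
  shows "j = j'"
proof -
  have aux: False
    if "x \<in> GF q K" "x \<noteq> 0" "y \<in> GF q K" "y \<noteq> 0"
      "w ^ j * x ^ (q - 1) = w ^ j' * y ^ (q - 1)" "j < j'" "j' \<le> q - 2"
    for x y :: 'a and j j' :: nat
  proof -
    have w0: "w \<noteq> 0" using w by (rule primitive_elem_nonzero)
    have "w ^ j' = w ^ j * w ^ (j' - j)" using \<open>j < j'\<close> by (simp flip: power_add)
    then have s: "(x / y) ^ (q - 1) = w ^ (j' - j)"
      using that w0 by (simp add: field_simps)
    have "[q = 1] (mod (q - 1))"
      using q_gt_1 by (auto simp: cong_def mod_if le_mod_geq)
    then have "[q ^ K = 1] (mod (q - 1))"
      using cong_pow[of q 1 "q - 1" K] by simp
    then have "q - 1 dvd q ^ K - 1" by (metis cong_to_1_nat)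
    then obtain M where M: "q ^ K - 1 = (q - 1) * M" by blast
    have "M > 0" using M q_power_gt_1[OF dvd_n_pos[OF K]] by (cases M) auto
    have "w ^ ((j' - j) * M) = (x / y) ^ (q ^ K - 1)"
      by (simp add: M power_mult s)
    also have "\<dots> = 1" using that by (intro GF_unit_power GF_divide) auto
    finally have "w ^ ((j' - j) * M) = 1" .
    moreover have "j' - j < q - 1" using \<open>j < j'\<close> \<open>j' \<le> q - 2\<close> q_gt_1 by linarith
    then have "(j' - j) * M < q ^ K - 1"
      unfolding M using \<open>M > 0\<close> by simp
    ultimately show False
      using primitive_elem_power_neq_1[OF K w, of "(j' - j) * M"] \<open>j < j'\<close> \<open>M > 0\<close> by simp
  qed
  show ?thesis
    using aux[OF xy eq _ j(2)] aux[OF xy(3,4,1,2) eq[symmetric] _ j(1)]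
    by (cases j j' rule: linorder_cases) blast+
qed

end

section \<open>The maps \<open>Phi\<close> as polynomials in \<open>g\<close>, and their
  rigidity\<close>

type_synonym 'a index = "nat \<times> 'a list \<times> 'a \<times> nat \<times> nat"

text \<open>An indeterminate replaces \<open>g\<close>. The argument \<open>u\<close> can be read
  off as the constant coefficient, since the second summand starts at degree at least 1.\<close>

definition Phi_poly :: "nat \<Rightarrow> 'a::{field,finite} \<Rightarrow> 'a index \<Rightarrow> 'a \<Rightarrow> 'a poly" where
  "Phi_poly q w h u = (case h of (l0, al, a, j, l1) \<Rightarrow>
      smult u (Poly (1 # al)) + monom (w ^ j * (u ^ q + a * u)) (l1 + 1))"

lemma poly_Phi_poly: "poly (Phi_poly q w h u) g = Phi q w g h u"
proof -
  have "poly (Poly (1 # al)) g = Ppoly al g" for al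
    by (simp add: Ppoly_def poly_Poly sum_distrib_left algebra_simps)
  then show ?thesis
    by (simp add: Phi_poly_def Phi_def poly_monom del: Poly.simps split: prod.split)
qed

lemma degree_Poly_Cons_le: "degree (Poly (x # xs)) \<le> length xs"
proof (rule degree_le, intro allI impI)
  fix i assume "length xs < i"
  then show "coeff (Poly (x # xs)) i = 0" by (cases i) (auto simp: nth_default_def)
qed

locale code_level = finite_field_tower q n ambient
  for q n :: nat and ambient :: "'a::{field,finite} itself" +
  fixes p K :: nat and w g :: 'a
  assumes p: "odd p" "p \<ge> 3" and pK_dvd: "p * K dvd n"
    and w: "primitive_elem q K w"
    and g: "g \<in> GF q (p * K)" "adjoin (GF q K) g = GF q (p * K)"
begin

abbreviation "ell \<equiv> (p - 3) div 2"
abbreviation "I \<equiv> (Idx q K ell :: 'a index set)"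
abbreviation "\<Phi> \<equiv> Phi q w g"

lemma K_dvd: "K dvd n"
  using pK_dvd by (rule dvd_mult_right)

lemma w_nonzero: "w \<noteq> 0"
  using w by (rule primitive_elem_nonzero)

lemma w_in: "w \<in> GF q K"
  using w by (simp add: primitive_elem_def)

lemma K_subset: "GF q K \<subseteq> (GF q (p * K) :: 'a set)"
  by (rule GF_mono) simp

lemma coeff_0_Phi_poly: "coeff (Phi_poly q w h u) 0 = u"
  by (simp add: Phi_poly_def split: prod.split)

lemma degree_Phi_poly: "h \<in> I \<Longrightarrow> degree (Phi_poly q w h u) \<le> ell + 1"
  by (auto simp: Phi_poly_def Idx_def simp del: Poly.simps
      intro!: degree_add_le order.trans[OF degree_smult_le] order.trans[OF degree_Poly_Cons_le]
        order.trans[OF degree_monom_le])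

lemma poly_over_Phi_poly:
  assumes "h \<in> I" "u \<in> GF q K"
  shows "poly_over (GF q K) (Phi_poly q w h u)"
proof -
  obtain l0 al a j l1 where h: "h = (l0, al, a, j, l1)" by (cases h)
  have "poly_over (GF q K) (Poly (1 # al))"
    using assms(1) unfolding poly_over_def
    by (auto simp: h Idx_def nth_default_def coeff_pCons subset_iff split: nat.split)
  then show ?thesis
    using assms w_in unfolding h Phi_poly_def prod.case
    by (intro poly_over_closed poly_over_smult poly_over_monom GF_closed) (auto simp: Idx_def)
qed

text \<open>Products of two maps still have degree below \<open>p\<close> in \<open>g\<close>, since \<open>2 (ell + 1) = p - 1\<close>.\<close>
lemma poly_over_g_eq_0:
  assumes "poly_over (GF q K) f" "degree f \<le> 2 * (ell + 1)" "poly f g = 0"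
  shows "f = 0"
proof (rule poly_over_root_eq_0[OF pK_dvd g(2) assms(1) _ assms(3)])
  show "degree f < p" using assms(2) p by (elim oddE) auto
qed

lemma Phi_in:
  assumes "h \<in> I" "u \<in> GF q K"
  shows "\<Phi> h u \<in> GF q (p * K)"
proof -
  have "\<Phi> h u = (\<Sum>i\<le>degree (Phi_poly q w h u). coeff (Phi_poly q w h u) i * g ^ i)"
    by (simp add: poly_altdef flip: poly_Phi_poly)
  also have "\<dots> \<in> GF q (p * K)"
    using poly_over_Phi_poly[OF assms] K_subset g(1)
    by (intro GF_sum GF_mult GF_power) (auto simp: poly_over_def)
  finally show ?thesis .
qed

text \<open>The degree is too small for \<open>g\<close> to be a root of a nonzero polynomial over
  \<open>GF q K\<close>, so the polynomial vanishes together with its constant coefficient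
  \<open>u\<close>.\<close>

lemma Phi_eq_0D:
  assumes "h \<in> I" "u \<in> GF q K" "\<Phi> h u = 0"
  shows "u = 0"
proof -
  have "Phi_poly q w h u = 0"
    using poly_over_Phi_poly[OF assms(1,2)] degree_Phi_poly[OF assms(1), of u] assms(3)
    by (intro poly_over_g_eq_0) (auto simp: poly_Phi_poly)
  then show ?thesis by (metis coeff_0 coeff_0_Phi_poly)
qed

lemma Phi_add: "\<Phi> h (u + v) = \<Phi> h u + \<Phi> h v"
  using frobenius_add[of u v 1] by (simp add: Phi_def algebra_simps split: prod.split)

lemma Phi_0: "\<Phi> h 0 = 0"
  using q_gt_1 by (simp add: Phi_def power_0_left split: prod.split)

lemma Phi_scale: "c \<in> Fq \<Longrightarrow> \<Phi> h (c * u) = c * \<Phi> h u"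
  by (simp add: Phi_def GF_def power_mult_distrib algebra_simps split: prod.split)

lemma Phi_inj: "h \<in> I \<Longrightarrow> inj_on (\<Phi> h) (GF q K)"
proof (rule inj_onI)
  fix u v assume *: "h \<in> I" "u \<in> GF q K" "v \<in> GF q K" "\<Phi> h u = \<Phi> h v"
  then have "\<Phi> h (u - v) = 0"
    using Phi_add[of h "u - v" v] by simp
  then show "u = v" using Phi_eq_0D[of h "u - v"] * GF_diff by simp
qed

lemma Phi_poly_cross:
  assumes h: "h \<in> I" "h' \<in> I" and b: "b \<noteq> 0" "b' \<noteq> 0"
    and u: "u1 \<in> GF q K" "u2 \<in> GF q K" "v1 \<in> GF q K" "v2 \<in> GF q K"
    and eq: "b * \<Phi> h u1 = b' * \<Phi> h' v1" "b * \<Phi> h u2 = b' * \<Phi> h' v2"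
  shows "Phi_poly q w h u1 * Phi_poly q w h' v2 = Phi_poly q w h u2 * Phi_poly q w h' v1"
proof -
  let ?A = "Phi_poly q w h" and ?B = "Phi_poly q w h'"
  have "(b * b') * (\<Phi> h u1 * \<Phi> h' v2) = (b * \<Phi> h u1) * (b' * \<Phi> h' v2)" by simp
  also have "\<dots> = (b * b') * (\<Phi> h u2 * \<Phi> h' v1)" by (simp add: eq(1) flip: eq(2))
  finally have "\<Phi> h u1 * \<Phi> h' v2 = \<Phi> h u2 * \<Phi> h' v1" using b by simp
  then have "poly (?A u1 * ?B v2 - ?A u2 * ?B v1) g = 0" by (simp add: poly_Phi_poly)
  moreover have "degree (?A u * ?B v) \<le> 2 * (ell + 1)" for u v
    using order.trans[OF degree_mult_le add_mono[OF degree_Phi_poly[OF h(1)] degree_Phi_poly[OF h(2)]]]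
    by (simp only: mult_2)
  then have "degree (?A u1 * ?B v2 - ?A u2 * ?B v1) \<le> 2 * (ell + 1)"
    by (intro degree_diff_le)
  moreover have "poly_over (GF q K) (?A u1 * ?B v2 - ?A u2 * ?B v1)"
    using u h by (intro poly_over_closed poly_over_Phi_poly)
  ultimately show ?thesis using poly_over_g_eq_0 by (metis eq_iff_diff_eq_0)
qed

lemma power_scale_eqD:
  assumes "x \<noteq> 0" "(t * x) ^ (q - 1) = x ^ (q - 1)"
  shows "t \<in> Fq"
  using assms by (intro GF_unit_subgroup_power) (simp add: power_mult_distrib)

text \<open>Two images with two \<open>Fq\<close>-independent common vectors come from the same map. With
  \<open>P + c x^m\<close> and \<open>Q + d x^m'\<close> the normalised polynomials of the two maps, the coefficients at \<open>0\<close> show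
  that both pairs of preimages have the same ratio \<open>t\<close>; then \<open>t\<close> lies in \<open>Fq\<close> or the polynomials
  coincide.\<close>
lemma Phi_collinear_or_same:
  assumes h: "h \<in> I" "h' \<in> I" and b: "b \<noteq> 0" "b' \<noteq> 0"
    and u: "u1 \<in> GF q K" "u2 \<in> GF q K" "v1 \<in> GF q K" "v2 \<in> GF q K" and "u1 \<noteq> 0"
    and eq: "b * \<Phi> h u1 = b' * \<Phi> h' v1" "b * \<Phi> h u2 = b' * \<Phi> h' v2"
  shows "(\<exists>c\<in>Fq. u2 = c * u1) \<or> (h = h' \<and> (\<exists>c\<in>Fq. c \<noteq> 0 \<and> b' = c * b))"
proof (cases "u2 = 0")
  case True
  then show ?thesis by (intro disjI1 bexI[of _ 0]) auto
next
  case False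
  obtain l0 al a j l1 where hh: "h = (l0, al, a, j, l1)" by (cases h)
  obtain l0' al' a' j' l1' where hh': "h' = (l0', al', a', j', l1')" by (cases h')
  define P Q where "P = Poly (1 # al)" and "Q = Poly (1 # al')"
  \<comment> \<open>Since \<open>x ^ q + a * x = x * (x ^ (q - 1) + a)\<close>, the factor
    \<open>x\<close> splits off from the whole polynomial; \<open>c x\<close> and \<open>d x\<close>
    are what remains of the coefficients at \<open>l1 + 1\<close> and
    \<open>l1' + 1\<close>.\<close>
  define c d where "c x = w ^ j * (x ^ (q - 1) + a)" and "d x = w ^ j' * (x ^ (q - 1) + a')" for x
  define X Y where "X x = P + monom (c x) (l1 + 1)" and "Y x = Q + monom (d x) (l1' + 1)" for x
  have powq: "x ^ q = x * x ^ (q - 1)" for x :: 'a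
    using q_gt_1 by (simp flip: power_Suc)
  have X: "Phi_poly q w h x = smult x (X x)" and Y: "Phi_poly q w h' x = smult x (Y x)" for x
    by (simp_all add: Phi_poly_def hh hh' X_def Y_def P_def Q_def c_def d_def smult_add_right
        smult_monom powq algebra_simps del: Poly.simps)
  have cross: "Phi_poly q w h u1 * Phi_poly q w h' v2 = Phi_poly q w h u2 * Phi_poly q w h' v1"
    by (rule Phi_poly_cross[OF h b u eq])
  then have uv: "u1 * v2 = u2 * v1"
    by (metis coeff_0_Phi_poly coeff_mult_0)
  have "v1 \<noteq> 0"
    using eq(1) b \<open>u1 \<noteq> 0\<close> Phi_eq_0D[OF h(1) u(1)] by (auto simp: Phi_0)
  define t where "t = u2 / u1"
  have t: "t \<noteq> 0" "u2 = t * u1" "v2 = t * v1"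
    using uv \<open>u1 \<noteq> 0\<close> False by (auto simp: t_def field_simps)
  have collinear: ?thesis if "t \<in> Fq" using that t by blast
  \<comment> \<open>Both sides of \<open>cross\<close> carry the same nonzero factor
    \<open>u1 * v2 = u2 * v1\<close>.\<close>
  have "smult (u1 * v2) (X u1 * Y v2 - X u2 * Y v1) = 0"
    using cross by (simp add: X Y uv mult.commute smult_diff_right)
  moreover have "u1 * v2 \<noteq> 0" using t \<open>u1 \<noteq> 0\<close> \<open>v1 \<noteq> 0\<close> by simp
  ultimately have "X u1 * Y v2 = X u2 * Y v1"
    using smult_eq_0_iff eq_iff_diff_eq_0 by blast
  moreover have "degree P < l1 + 1" "degree Q < l1' + 1" "coeff P 0 = 1" "coeff Q 0 = 1"
    using degree_Poly_Cons_le[of 1 al] degree_Poly_Cons_le[of 1 al'] h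
    by (simp_all add: P_def Q_def hh hh' Idx_def)
  ultimately consider "c u1 = c u2" | "d v1 = d v2"
    | "l1 = l1'" "P = Q" "c u1 = d v1" "c u2 = d v2"
    using poly_cross_identity[of P "l1 + 1" Q "l1' + 1" "c u1" "d v2" "c u2" "d v1"]
    unfolding X_def Y_def by force
  then show ?thesis
  proof cases
    \<comment> \<open>With \<open>u2 = t * u1\<close>, equal values of \<open>c\<close> force
      \<open>t ^ (q - 1) = 1\<close>, so \<open>t\<close> lies in \<open>Fq\<close>; the next case
      is the same for \<open>d\<close>.\<close>
    case 1
    then show ?thesis
      using power_scale_eqD[OF \<open>u1 \<noteq> 0\<close>, of t] w_nonzero t collinear by (simp add: c_def)
  next
    case 2
    then show ?thesis
      using power_scale_eqD[OF \<open>v1 \<noteq> 0\<close>, of t] w_nonzero t collinear by (simp add: d_def)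
  next
    case 3
    show ?thesis
    proof (cases "t \<in> Fq")
      case False
      then have t1: "t ^ (q - 1) \<noteq> 1" using GF_unit_subgroup_power by blast
      \<comment> \<open>Differences eliminate \<open>a\<close> and \<open>a'\<close>; the common
        factor \<open>t ^ (q - 1) - 1\<close> is nonzero and cancels, leaving only the power classes
        to compare.\<close>
      have "c u2 - c u1 = w ^ j * u1 ^ (q - 1) * (t ^ (q - 1) - 1)"
        "d v2 - d v1 = w ^ j' * v1 ^ (q - 1) * (t ^ (q - 1) - 1)"
        by (simp_all add: c_def d_def t power_mult_distrib algebra_simps)
      then have lead: "w ^ j * u1 ^ (q - 1) = w ^ j' * v1 ^ (q - 1)"
        using t1 3 by simp
      have j: "j = j'"
        using h \<open>u1 \<noteq> 0\<close> \<open>v1 \<noteq> 0\<close> u lead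
        by (intro primitive_elem_power_class[OF K_dvd w, of u1 v1]) (auto simp: hh hh' Idx_def)
      then have pow: "u1 ^ (q - 1) = v1 ^ (q - 1)" using lead w_nonzero by simp
      then have a: "a = a'" using 3 j w_nonzero by (simp add: c_def d_def)
      have al: "al = al'"
        using 3 h unfolding P_def Q_def by (intro Poly_one_Cons_eqD) (auto simp: hh hh' Idx_def)
      have hh_eq: "h = h'" using h al a j 3 by (auto simp: hh hh' Idx_def)
      \<comment> \<open>The ratio of the preimages passes to the scalars: \<open>r\<close> lies in
        \<open>Fq\<close>, so it can be pulled out of \<open>\<Phi> h (r * v1)\<close>.\<close>
      define r where "r = u1 / v1"
      have r: "r \<noteq> 0" "u1 = r * v1" using \<open>u1 \<noteq> 0\<close> \<open>v1 \<noteq> 0\<close> by (auto simp: r_def)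
      have "r \<in> Fq" using power_scale_eqD[OF \<open>v1 \<noteq> 0\<close>, of r] pow r by simp
      moreover have "\<Phi> h v1 \<noteq> 0" using Phi_eq_0D[OF h(1) u(3)] \<open>v1 \<noteq> 0\<close> by blast
      ultimately have "b' = r * b"
        using eq(1) by (simp add: r(2) Phi_scale mult.commute flip: hh_eq)
      then show ?thesis using hh_eq r \<open>r \<in> Fq\<close> by blast
    qed (rule collinear)
  qed
qed

end

section \<open>Codes with pairwise intersections of dimension at most one\<close>

lemma smul_smul: "smul a (smul b V) = smul (a * b) V"
  by (auto simp: smul_def image_iff mult.assoc)

lemma smul_1: "smul 1 V = V"
  by (simp add: smul_def)

lemma card_smul: "b \<noteq> 0 \<Longrightarrow> card (smul b V) = card V"
  unfolding smul_def by (rule card_image) (simp add: inj_on_def)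

lemma Fsubspace_smul: "Fsubspace F V \<Longrightarrow> Fsubspace F (smul b V)"
  unfolding smul_def Fsubspace_def
  by (auto simp: image_iff mult.left_commute simp flip: distrib_left)

context finite_field_tower
begin

text \<open>The bound on intersections is stated for pairs of vectors instead of through
  \<open>Fdim\<close>, because a pair of common vectors can be pulled back directly along the maps
  \<open>Phi\<close>.\<close>

definition sparse_code :: "nat \<Rightarrow> nat \<Rightarrow> 'a set set \<Rightarrow> bool" where
  "sparse_code N k C \<longleftrightarrow>
     (\<forall>U\<in>C. Fsubspace Fq U \<and> U \<subseteq> GF q N \<and> card U = q ^ k) \<and>
     (\<forall>U\<in>C. \<forall>V\<in>C. U \<noteq> V \<longrightarrow> (\<forall>x\<in>U \<inter> V. \<forall>y\<in>U \<inter> V. x \<noteq> 0 \<longrightarrow> (\<exists>c\<in>Fq. y = c * x)))"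

lemma sparse_codeD:
  assumes "sparse_code N k C" "U \<in> C"
  shows "Fsubspace Fq U" "U \<subseteq> GF q N" "card U = q ^ k"
    and "V \<in> C \<Longrightarrow> U \<noteq> V \<Longrightarrow> x \<in> U \<inter> V \<Longrightarrow> y \<in> U \<inter> V \<Longrightarrow> x \<noteq> 0 \<Longrightarrow> \<exists>c\<in>Fq. y = c * x"
  using assms unfolding sparse_code_def by blast+

lemma Fsubspace_GF: "Fsubspace Fq (GF q N :: 'a set)"
  using Fq_subset[of N] by (auto simp: Fsubspace_def intro: GF_add GF_mult)

lemma smul_Fq:
  assumes "Fsubspace Fq V" "c \<in> Fq" "c \<noteq> 0"
  shows "smul c V = V"
proof
  show "smul c V \<subseteq> V" using assms by (auto simp: smul_def Fsubspace_def)
  show "V \<subseteq> smul c V"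
  proof
    fix x assume "x \<in> V"
    moreover have "inverse c \<in> Fq" using assms by (intro GF_inverse)
    ultimately have "inverse c * x \<in> V" using assms by (auto simp: Fsubspace_def)
    then show "x \<in> smul c V"
      unfolding smul_def using assms(3) by (intro image_eqI[of _ _ "inverse c * x"]) auto
  qed
qed

lemma card_Fq_line: "card ((\<lambda>c. c * x) ` Fq) \<le> q"
  using card_image_le[of Fq "\<lambda>c. c * x"] by (simp add: card_Fq)

text \<open>A set of at least \<open>q ^ 2\<close> elements does not fit on an
  \<open>Fq\<close>-line, which has at most \<open>q\<close>.\<close>

lemma noncollinear_pair:
  assumes "card V = q ^ k" "k \<ge> 2"
  obtains x y :: 'a where "x \<in> V" "y \<in> V" "x \<noteq> 0" "\<And>c. c \<in> Fq \<Longrightarrow> y \<noteq> c * x"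
proof -
  have big: "q ^ 1 < card V"
    unfolding assms(1) using q_gt_1 assms(2) by (intro power_strict_increasing) auto
  obtain x where x: "x \<in> V" "x \<noteq> 0"
  proof (rule ccontr)
    assume "\<not> thesis"
    then have "V \<subseteq> {0}" using that by blast
    then have "card V \<le> 1" using card_mono[of "{0}" V] by simp
    then show False using big q_gt_1 by simp
  qed
  have "\<not> V \<subseteq> (\<lambda>c. c * x) ` Fq"
    using card_mono[of "(\<lambda>c. c * x) ` Fq" V] card_Fq_line[of x] big by auto
  then show thesis using that x by blast
qed

text \<open>A code closed under nonzero scalars is the union of the orbits of its own members, so
  \<open>C\<close> itself serves as the set of representatives.\<close>

lemma sparse_code_multi_orbit_cyclic:
  assumes C: "sparse_code n k C"
    and closed: "\<And>U b. U \<in> C \<Longrightarrow> b \<noteq> 0 \<Longrightarrow> smul b U \<in> C"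
  shows "multi_orbit_cyclic q n k C"
  unfolding multi_orbit_cyclic_def
proof
  show "C \<subseteq> Grass q n k"
    using sparse_codeD[OF C] by (auto simp: Grass_def intro: Fdim_eqI)
  have "C = (\<Union>V\<in>C. Orb q n V)"
  proof
    show "C \<subseteq> (\<Union>V\<in>C. Orb q n V)"
    proof
      fix U assume "U \<in> C"
      moreover have "U \<in> Orb q n U"
        unfolding Orb_def using smul_1[of U] by (intro CollectI exI[of _ 1]) auto
      ultimately show "U \<in> (\<Union>V\<in>C. Orb q n V)" by blast
    qed
    show "(\<Union>V\<in>C. Orb q n V) \<subseteq> C" using closed by (auto simp: Orb_def)
  qed
  then show "\<exists>R. C = (\<Union>V\<in>R. Orb q n V)" by blast
qed

lemma sparse_code_min_dist:
  assumes C: "sparse_code n k C" and "k \<ge> 2" "C \<noteq> {}"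
    and closed: "\<And>U b. U \<in> C \<Longrightarrow> b \<noteq> 0 \<Longrightarrow> smul b U \<in> C"
    and stab: "\<And>U b. U \<in> C \<Longrightarrow> b \<noteq> 0 \<Longrightarrow> smul b U = U \<Longrightarrow> b \<in> Fq"
  shows "min_dist q C = 2 * k - 2"
proof -
  have dim: "Fdim Fq U = k" if "U \<in> C" for U
    using sparse_codeD[OF C that] by (intro Fdim_eqI)
  have sdist: "sdist q U V = 2 * k - 2 * Fdim Fq (U \<inter> V)" if "U \<in> C" "V \<in> C" for U V
    using sdist_eq[of U V] sparse_codeD(1)[OF C] dim that by simp
  have cardI: "card (U \<inter> V) = q ^ Fdim Fq (U \<inter> V)" if "U \<in> C" "V \<in> C" for U V
    using sparse_codeD(1)[OF C] that by (intro card_Fsubspace Fsubspace_Int)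
  have dim_le: "Fdim Fq (U \<inter> V) \<le> 1" if UV: "U \<in> C" "V \<in> C" "U \<noteq> V" for U V
  proof -
    have "card (U \<inter> V) \<le> q"
    proof (cases "U \<inter> V \<subseteq> {0}")
      case True
      then have "card (U \<inter> V) \<le> 1" using card_mono[of "{0}" "U \<inter> V"] by simp
      then show ?thesis using q_gt_1 by simp
    next
      case False
      then obtain x where x: "x \<in> U \<inter> V" "x \<noteq> 0" by blast
      then have "U \<inter> V \<subseteq> (\<lambda>c. c * x) ` Fq"
        using sparse_codeD(4)[OF C UV(1,2,3) x(1) _ x(2)] by blast
      then have "card (U \<inter> V) \<le> card ((\<lambda>c. c * x) ` Fq)" by (intro card_mono) auto
      then show ?thesis using card_Fq_line[of x] by linarith
    qed
    then have "q ^ Fdim Fq (U \<inter> V) \<le> q ^ 1" using cardI[OF UV(1,2)] by simp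
    then show ?thesis using q_gt_1 power_increasing_iff by blast
  qed
  obtain U where U: "U \<in> C" using \<open>C \<noteq> {}\<close> by blast
  obtain x y where xy: "x \<in> U" "y \<in> U" "x \<noteq> 0" and nc: "\<And>c. c \<in> Fq \<Longrightarrow> y \<noteq> c * x"
    using noncollinear_pair[OF sparse_codeD(3)[OF C U] \<open>k \<ge> 2\<close>] by blast
  have y: "y \<noteq> 0" using nc[of 0] by auto
  \<comment> \<open>\<open>x = (x / y) * y\<close> is common to \<open>U\<close> and
    \<open>V\<close>, while \<open>stab\<close> separates them because \<open>x / y\<close> is not
    in \<open>Fq\<close>.\<close>
  define V where "V = smul (x / y) U"
  have V: "V \<in> C" using closed[OF U, of "x / y"] xy y by (simp add: V_def)
  have "U \<noteq> V"
  proof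
    assume "U = V"
    then have "x / y \<in> Fq" using stab[OF U, of "x / y"] xy y by (simp add: V_def)
    then have "inverse (x / y) \<in> Fq" by (rule GF_inverse)
    then show False using nc[of "inverse (x / y)"] xy by simp
  qed
  have "x \<in> V" unfolding V_def smul_def using xy y by (intro image_eqI[of _ _ y]) auto
  moreover have "0 \<in> U" "0 \<in> V" using sparse_codeD(1)[OF C] U V Fsubspace_zero by blast+
  ultimately have "card {0, x} \<le> card (U \<inter> V)" using xy by (intro card_mono) auto
  then have "Fdim Fq (U \<inter> V) \<noteq> 0" using cardI[OF U V] xy by (intro notI) simp
  then have "Fdim Fq (U \<inter> V) = 1" using dim_le[OF U V \<open>U \<noteq> V\<close>] by linarith
  then have attained: "sdist q U V = 2 * k - 2" using sdist[OF U V] by simp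
  have "2 * k - 2 \<le> sdist q U V" if "U \<in> C" "V \<in> C" "U \<noteq> V" for U V
    using dim_le[OF that] sdist[OF that(1,2)] by linarith
  then show ?thesis
    unfolding min_dist_def
  proof (intro Min_eqI)
    show "2 * k - 2 \<in> {sdist q U V |U V. U \<in> C \<and> V \<in> C \<and> U \<noteq> V}"
      using attained U V \<open>U \<noteq> V\<close> by force
    have "{sdist q U V |U V. U \<in> C \<and> V \<in> C \<and> U \<noteq> V} \<subseteq> (\<lambda>(U, V). sdist q U V) ` (C \<times> C)"
      by auto
    then show "finite {sdist q U V |U V. U \<in> C \<and> V \<in> C \<and> U \<noteq> V}"
      by (rule finite_subset) simp
  qed auto
qed

end

section \<open>Counting the indices, and the lifting step\<close>

lemma card_lists_last_nonzero:
  fixes F :: "'a::zero set"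
  assumes "finite F" "0 \<in> F"
  shows "card {xs. length xs \<le> l \<and> set xs \<subseteq> F \<and> (xs \<noteq> [] \<longrightarrow> last xs \<noteq> 0)} = card F ^ l"
    (is "card (?T l) = _")
proof (induction l)
  case 0
  have "?T 0 = {[]}" by auto
  then show ?case by simp
next
  case (Suc l)
  let ?L = "{xs. set xs \<subseteq> F \<and> length xs = l}"
  \<comment> \<open>\<open>?E\<close> collects the lists of length exactly \<open>Suc l\<close>. Its
    \<open>card F ^ l * (card F - 1)\<close> members complete \<open>card F ^ l\<close> to
    \<open>card F ^ Suc l\<close>.\<close>
  let ?E = "(\<lambda>(xs, x). xs @ [x]) ` (?L \<times> (F - {0}))"
  have "?T (Suc l) = ?T l \<union> ?E"
  proof (intro equalityI subsetI)
    fix xs assume xs: "xs \<in> ?T (Suc l)"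
    show "xs \<in> ?T l \<union> ?E"
    proof (cases "length xs \<le> l")
      case False
      then have len: "length xs = Suc l" using xs by simp
      then have ne: "xs \<noteq> []" by auto
      have "set (butlast xs) \<subseteq> F" using xs by (auto dest: in_set_butlastD)
      moreover have "last xs \<in> F - {0}" using xs ne last_in_set by auto
      ultimately have "xs \<in> ?E"
        using ne len by (intro image_eqI[of _ _ "(butlast xs, last xs)"]) auto
      then show ?thesis ..
    qed (use xs in simp)
  qed auto
  moreover have "?T l \<inter> ?E = {}" by auto
  moreover have "finite (?T l)"
    by (rule finite_subset[OF _ finite_lists_length_le[OF assms(1), of l]]) auto
  moreover have "finite ?E"
    using assms(1) by (intro finite_imageI finite_cartesian_product finite_lists_length_eq) auto
  moreover have "card ?E = card F ^ l * (card F - 1)"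
  proof -
    have "card ?E = card (?L \<times> (F - {0}))"
      by (rule card_image) (auto simp: inj_on_def)
    then show ?thesis
      using assms by (simp add: card_cartesian_product card_lists_length_eq)
  qed
  ultimately have "card (?T (Suc l)) = card F ^ l + card F ^ l * (card F - 1)"
    using Suc.IH by (simp add: card_Un_disjoint)
  moreover have "card F > 0" using assms by (auto simp: card_gt_0_iff)
  then obtain f where "card F = Suc f" using gr0_implies_Suc by blast
  ultimately show ?case by simp
qed

context code_level
begin

lemma finite_I: "finite I"
proof (rule finite_subset)
  show "I \<subseteq> {..ell} \<times> {xs. set xs \<subseteq> UNIV \<and> length xs \<le> ell} \<times> UNIV \<times> {..q - 2} \<times> {..ell}"
    by (auto simp: Idx_def)
qed (intro finite_cartesian_product finite_lists_length_le; simp)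

text \<open>For fixed \<open>l1\<close> there are \<open>(q ^ K) ^ l1\<close> tuples,
  \<open>q ^ K\<close> values of \<open>a\<close> and \<open>q - 1\<close> values of
  \<open>j\<close>; the factor \<open>q ^ K - 1\<close> sums the geometric series over
  \<open>l1\<close>.\<close>

lemma card_I: "real (card I) * (real q ^ K - 1) = real q ^ K * (real q ^ ((ell + 1) * K) - 1) * (real q - 1)"
proof -
  define T where "T l = {al. length al \<le> l \<and> set al \<subseteq> GF q K \<and> (al \<noteq> [] \<longrightarrow> last al \<noteq> (0::'a))}" for l
  let ?S = "SIGMA l1:{..ell}. T l1 \<times> (GF q K :: 'a set) \<times> {..q - 2}"
  have card_T: "card (T l) = (q ^ K) ^ l" for l
    unfolding T_def using card_lists_last_nonzero[of "GF q K :: 'a set" l] by (simp add: card_GF[OF K_dvd])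
  have card_j: "card {..q - 2} = q - 1" using q_gt_1 by simp
  have "finite (T l)" for l
    by (rule finite_subset[OF _ finite_lists_length_le[of "GF q K" l]]) (auto simp: T_def)
  \<comment> \<open>The component \<open>l0\<close> is recovered as
    \<open>length al\<close>.\<close>
  have "bij_betw (\<lambda>(l1, al, a, j). (length al, al, a, j, l1)) ?S I"
    by (rule bij_betwI[where g = "\<lambda>(l0, al, a, j, l1). (l1, al, a, j)"])
      (auto simp: T_def Idx_def)
  then have "card I = card ?S" by (simp add: bij_betw_same_card)
  also have "\<dots> = (\<Sum>l1\<le>ell. (q ^ K) ^ l1 * (q ^ K * (q - 1)))"
    using \<open>\<And>l. finite (T l)\<close>
    by (simp add: card_cartesian_product card_T card_GF[OF K_dvd] card_j del: card_atMost)
  also have "\<dots> = (\<Sum>l1<Suc ell. (q ^ K) ^ l1) * (q ^ K * (q - 1))"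
    by (simp only: sum_distrib_right lessThan_Suc_atMost)
  finally have "real (card I) = (\<Sum>l1<Suc ell. (real q ^ K) ^ l1) * (real q ^ K * (real q - 1))"
    using q_gt_1 by (simp add: of_nat_diff)
  moreover have "(real q ^ K - 1) * (\<Sum>l1<Suc ell. (real q ^ K) ^ l1) = real q ^ ((ell + 1) * K) - 1"
  proof -
    have "(real q ^ K) ^ Suc ell = real q ^ ((ell + 1) * K)"
      by (simp only: power_mult[symmetric] Suc_eq_plus1 mult.commute)
    then show ?thesis by (simp only: power_diff_1_eq[symmetric])
  qed
  ultimately show ?thesis
    by (simp only: mult.assoc[symmetric] mult.commute[of _ "real q ^ K - 1"]) (simp only: mult_ac)
qed

definition lift :: "'a set set \<Rightarrow> 'a set set" where
  "lift C = {smul b (\<Phi> h ` U) | b h U. b \<in> GF q (p * K) - {0} \<and> h \<in> I \<and> U \<in> C}"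

lemma Fsubspace_Phi_image:
  assumes "Fsubspace Fq U"
  shows "Fsubspace Fq (\<Phi> h ` U)"
  unfolding Fsubspace_def
proof (intro conjI ballI)
  show "0 \<in> \<Phi> h ` U"
    using assms Phi_0[of h] by (intro image_eqI[of _ _ 0]) (auto simp: Fsubspace_zero)
next
  fix x y assume "x \<in> \<Phi> h ` U" "y \<in> \<Phi> h ` U"
  then obtain u v where "x = \<Phi> h u" "y = \<Phi> h v" "u \<in> U" "v \<in> U" by blast
  then show "x + y \<in> \<Phi> h ` U"
    using assms by (intro image_eqI[of _ _ "u + v"]) (auto simp: Phi_add Fsubspace_def)
next
  fix c x assume "c \<in> Fq" "x \<in> \<Phi> h ` U"
  moreover from this obtain u where "x = \<Phi> h u" "u \<in> U" by blast
  ultimately show "c * x \<in> \<Phi> h ` U"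
    using assms by (intro image_eqI[of _ _ "c * u"]) (auto simp: Phi_scale Fsubspace_def)
qed

context
  fixes C :: "'a set set" and k :: nat
  assumes C: "sparse_code K k C"
begin

lemma lift_members:
  assumes "b \<in> GF q (p * K) - {0}" "h \<in> I" "U \<in> C"
  shows "Fsubspace Fq (smul b (\<Phi> h ` U))" "smul b (\<Phi> h ` U) \<subseteq> GF q (p * K)"
    "card (smul b (\<Phi> h ` U)) = q ^ k"
proof -
  note U = sparse_codeD[OF C assms(3)]
  show "Fsubspace Fq (smul b (\<Phi> h ` U))"
    using U(1) by (intro Fsubspace_smul Fsubspace_Phi_image)
  show "smul b (\<Phi> h ` U) \<subseteq> GF q (p * K)"
    using assms U(2) by (auto simp: smul_def intro!: GF_mult Phi_in)
  show "card (smul b (\<Phi> h ` U)) = q ^ k"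
    using assms U(2,3) card_image[OF inj_on_subset[OF Phi_inj[OF assms(2)] U(2)]]
    by (simp add: card_smul)
qed

text \<open>If the maps agree and the scalars are \<open>Fq\<close>-proportional, the preimages
  differ by the same factor, so both preimages on the \<open>U\<close> side lie in
  \<open>U \<inter> U'\<close> and sparsity of \<open>C\<close> decides.\<close>

lemma lift_overlap:
  assumes h: "h \<in> I" "h' \<in> I" and b: "b \<noteq> 0" "b' \<noteq> 0" and U: "U \<in> C" "U' \<in> C"
    and x: "x \<in> smul b (\<Phi> h ` U)" "x \<in> smul b' (\<Phi> h' ` U')" "x \<noteq> 0"
    and y: "y \<in> smul b (\<Phi> h ` U)" "y \<in> smul b' (\<Phi> h' ` U')"
  shows "(\<exists>c\<in>Fq. y = c * x) \<or> (h = h' \<and> U = U' \<and> (\<exists>c\<in>Fq. c \<noteq> 0 \<and> b' = c * b))"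
proof -
  obtain u1 v1 where 1: "u1 \<in> U" "v1 \<in> U'" "x = b * \<Phi> h u1" "x = b' * \<Phi> h' v1"
    using x by (auto simp: smul_def)
  obtain u2 v2 where 2: "u2 \<in> U" "v2 \<in> U'" "y = b * \<Phi> h u2" "y = b' * \<Phi> h' v2"
    using y by (auto simp: smul_def)
  note subK = sparse_codeD(2)[OF C U(1)] sparse_codeD(2)[OF C U(2)]
  have in_K: "u1 \<in> GF q K" "u2 \<in> GF q K" "v1 \<in> GF q K" "v2 \<in> GF q K"
    using subK 1 2 by blast+
  have "u1 \<noteq> 0" using x(3) 1(3) Phi_0[of h] by auto
  have collinear: ?thesis if "c \<in> Fq" "u2 = c * u1" for c
  proof -
    have "y = c * x" by (simp add: 1(3) 2(3) that(2) Phi_scale[OF that(1)])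
    then show ?thesis using that(1) by blast
  qed
  from Phi_collinear_or_same[OF h b in_K \<open>u1 \<noteq> 0\<close>] 1 2
  consider c where "c \<in> Fq" "u2 = c * u1"
    | c where "h = h'" "c \<in> Fq" "c \<noteq> 0" "b' = c * b"
    by metis
  then show ?thesis
  proof cases
    case 1
    then show ?thesis by (rule collinear)
  next
    case c: 2
    have eq: "u = c * v" if "b * \<Phi> h u = b' * \<Phi> h' v" "u \<in> GF q K" "v \<in> GF q K" for u v
    proof -
      have "\<Phi> h u = \<Phi> h (c * v)" using that(1) c b by (simp add: Phi_scale)
      moreover have "c * v \<in> GF q K" using c(2) Fq_subset that(3) by (intro GF_mult) blast+
      ultimately show ?thesis using inj_onD[OF Phi_inj[OF h(1)]] that(2) by blast
    qed
    have "u1 = c * v1" "u2 = c * v2"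
      using 1 2 in_K by (auto intro!: eq)
    then have "u1 \<in> U \<inter> U'" "u2 \<in> U \<inter> U'"
      using 1 2 c(2) sparse_codeD(1)[OF C U(2)] by (auto simp: Fsubspace_def)
    then have "U = U' \<or> (\<exists>c\<in>Fq. u2 = c * u1)"
      using sparse_codeD(4)[OF C U(1,2)] \<open>u1 \<noteq> 0\<close> by blast
    then show ?thesis using c collinear by blast
  qed
qed

context
  assumes k: "k \<ge> 2"
begin

text \<open>Equal spaces share an independent pair because \<open>k \<ge> 2\<close>, which excludes
  the collinear alternative of \<open>lift_overlap\<close>.\<close>

lemma lift_eqD:
  assumes "b \<in> GF q (p * K) - {0}" "h \<in> I" "U \<in> C" "b' \<noteq> 0" "h' \<in> I" "U' \<in> C"
    and "smul b (\<Phi> h ` U) = smul b' (\<Phi> h' ` U')"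
  shows "h = h' \<and> U = U' \<and> (\<exists>c\<in>Fq. c \<noteq> 0 \<and> b' = c * b)"
proof -
  obtain x y where "x \<in> smul b (\<Phi> h ` U)" "y \<in> smul b (\<Phi> h ` U)" "x \<noteq> 0"
    "\<And>c. c \<in> Fq \<Longrightarrow> y \<noteq> c * x"
    using noncollinear_pair[OF lift_members(3)[OF assms(1-3)] k] by blast
  then show ?thesis
    using lift_overlap[of h h' b b' U U' x y] assms by blast
qed

lemma sparse_code_lift: "sparse_code (p * K) k (lift C)"
  unfolding sparse_code_def
proof (intro conjI ballI impI)
  fix U assume "U \<in> lift C"
  then obtain b h U0 where "U = smul b (\<Phi> h ` U0)" "b \<in> GF q (p * K) - {0}" "h \<in> I" "U0 \<in> C"
    unfolding lift_def by blast
  then show "Fsubspace Fq U" "U \<subseteq> GF q (p * K)" "card U = q ^ k"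
    using lift_members by blast+
next
  fix U V x y
  assume UV: "U \<in> lift C" "V \<in> lift C" "U \<noteq> V" and xy: "x \<in> U \<inter> V" "y \<in> U \<inter> V" "x \<noteq> 0"
  obtain b h U0 where U: "U = smul b (\<Phi> h ` U0)" "b \<in> GF q (p * K) - {0}" "h \<in> I" "U0 \<in> C"
    using UV(1) unfolding lift_def by blast
  obtain b' h' V0 where V: "V = smul b' (\<Phi> h' ` V0)" "b' \<in> GF q (p * K) - {0}" "h' \<in> I" "V0 \<in> C"
    using UV(2) unfolding lift_def by blast
  have "(\<exists>c\<in>Fq. y = c * x) \<or> (h = h' \<and> U0 = V0 \<and> (\<exists>c\<in>Fq. c \<noteq> 0 \<and> b' = c * b))"
    using lift_overlap[of h h' b b' U0 V0 x y] U V xy by blast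
  \<comment> \<open>In the second alternative \<open>V\<close> is a nonzero
    \<open>Fq\<close>-multiple of \<open>U\<close>, hence \<open>U\<close> itself.\<close>
  moreover have "U = V" if "h = h'" "U0 = V0" "c \<in> Fq" "c \<noteq> 0" "b' = c * b" for c
  proof -
    have "V = smul c U" by (simp add: that U(1) V(1) smul_smul)
    then show ?thesis
      using smul_Fq[of U c] lift_members(1)[OF U(2-4)] that U(1) by simp
  qed
  ultimately show "\<exists>c\<in>Fq. y = c * x" using UV(3) by blast
qed

lemma lift_smul_closed:
  assumes "U \<in> lift C" "b \<in> GF q (p * K)" "b \<noteq> 0"
  shows "smul b U \<in> lift C"
proof -
  obtain b0 h U0 where U: "U = smul b0 (\<Phi> h ` U0)" "b0 \<in> GF q (p * K) - {0}" "h \<in> I" "U0 \<in> C"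
    using assms(1) unfolding lift_def by blast
  have "smul b U = smul (b * b0) (\<Phi> h ` U0)" by (simp add: U(1) smul_smul)
  moreover have "b * b0 \<in> GF q (p * K) - {0}" using U(2) assms by (auto intro: GF_mult)
  ultimately show ?thesis unfolding lift_def using U(3,4) by blast
qed

text \<open>A stabilizing \<open>b\<close> gives two descriptions of the same codeword, with scalars
  \<open>b0\<close> and \<open>b * b0\<close>, which \<open>lift_eqD\<close> makes
  \<open>Fq\<close>-proportional.\<close>

lemma lift_stabilizer:
  assumes "U \<in> lift C" "b \<noteq> 0" "smul b U = U"
  shows "b \<in> Fq"
proof -
  obtain b0 h U0 where U: "U = smul b0 (\<Phi> h ` U0)" "b0 \<in> GF q (p * K) - {0}" "h \<in> I" "U0 \<in> C"
    using assms(1) unfolding lift_def by blast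
  have "smul b0 (\<Phi> h ` U0) = smul (b * b0) (\<Phi> h ` U0)"
    using assms(3) by (simp add: U(1) smul_smul)
  then obtain c where "c \<in> Fq" "b * b0 = c * b0"
    using lift_eqD[of b0 h U0 "b * b0" h U0] U assms(2) by auto
  then show ?thesis using U(2) by simp
qed

lemma card_lift_times: "(q ^ (p * K) - 1) * (card I * card C) = card (lift C) * (q - 1)"
proof -
  let ?A = "(GF q (p * K) - {0::'a}) \<times> I \<times> C"
  let ?f = "\<lambda>(b, h, U). smul b (\<Phi> h ` U)"
  have "finite ?A" using finite_I by (intro finite_cartesian_product) simp_all
  then have "card ?A = card (?f ` ?A) * (q - 1)"
  proof (rule card_eq_card_image_times_fiber)
    fix z assume "z \<in> ?A"
    then obtain b h U where z: "z = (b, h, U)" "b \<in> GF q (p * K) - {0}" "h \<in> I" "U \<in> C"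
      by blast
    have "{z' \<in> ?A. ?f z' = ?f z} = (\<lambda>c. (c * b, h, U)) ` (Fq - {0})"
    proof (intro equalityI subsetI)
      fix z' assume z': "z' \<in> {z' \<in> ?A. ?f z' = ?f z}"
      then obtain b' h' U' where *: "z' = (b', h', U')" "b' \<in> GF q (p * K) - {0}" "h' \<in> I" "U' \<in> C"
        by (cases z') auto
      then have "h = h' \<and> U = U' \<and> (\<exists>c\<in>Fq. c \<noteq> 0 \<and> b' = c * b)"
        using z' by (intro lift_eqD[OF z(2-4)]) (auto simp: z(1))
      then show "z' \<in> (\<lambda>c. (c * b, h, U)) ` (Fq - {0})" using *(1) by blast
    next
      fix z' assume "z' \<in> (\<lambda>c. (c * b, h, U)) ` (Fq - {0})"
      then obtain c where c: "c \<in> Fq" "c \<noteq> 0" "z' = (c * b, h, U)" by blast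
      have "c * b \<in> GF q (p * K)" using c(1) Fq_subset z(2) by (intro GF_mult) blast+
      moreover have "smul (c * b) (\<Phi> h ` U) = smul b (\<Phi> h ` U)"
        using smul_Fq[OF lift_members(1)[OF z(2-4)] c(1,2)] by (simp add: smul_smul)
      ultimately show "z' \<in> {z' \<in> ?A. ?f z' = ?f z}" using z c by auto
    qed
    moreover have "card \<dots> = card (Fq - {0})"
      using z(2) by (intro card_image) (auto simp: inj_on_def)
    ultimately show "card {z' \<in> ?A. ?f z' = ?f z} = q - 1"
      by (simp add: card_Diff_singleton card_Fq)
  qed
  moreover have "?f ` ?A = lift C"
  proof (intro equalityI subsetI)
    fix V assume "V \<in> ?f ` ?A"
    then obtain z where z: "z \<in> ?A" "V = ?f z" by blast
    obtain b h U where "z = (b, h, U)" by (rule prod_cases3)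
    with z have "V = smul b (\<Phi> h ` U)" "b \<in> GF q (p * K) - {0}" "h \<in> I" "U \<in> C"
      by simp_all
    then show "V \<in> lift C" unfolding lift_def by blast
  next
    fix V assume "V \<in> lift C"
    then obtain b h U where "V = smul b (\<Phi> h ` U)" "b \<in> GF q (p * K) - {0}" "h \<in> I" "U \<in> C"
      unfolding lift_def by blast
    then show "V \<in> ?f ` ?A" by (intro image_eqI[of _ _ "(b, h, U)"]) simp_all
  qed
  moreover have "card (GF q (p * K) - {0::'a}) = q ^ (p * K) - 1"
    by (simp add: card_Diff_singleton card_GF[OF pK_dvd])
  ultimately show ?thesis by (simp add: card_cartesian_product)
qed

text \<open>The fibre size \<open>q - 1\<close> cancels against the \<open>q - 1\<close> values of
  \<open>j\<close> counted in \<open>card_I\<close>.\<close>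

lemma card_lift:
  "real (card (lift C)) = real (card C) * (real q ^ K * (real q ^ ((ell + 1) * K) - 1)
      * (real q ^ (p * K) - 1) / (real q ^ K - 1))"
proof -
  have q: "real q > 1" "real q ^ K > 1"
    using q_gt_1 one_less_power[of "real q" K] dvd_n_pos[OF K_dvd] by simp_all
  have "real ((q ^ (p * K) - 1) * (card I * card C)) = real (card (lift C) * (q - 1))"
    by (simp only: card_lift_times)
  then have *: "(real q ^ (p * K) - 1) * (real (card I) * real (card C)) = real (card (lift C)) * (real q - 1)"
    using q_gt_1 by (simp add: of_nat_diff)
  have "(real (card (lift C)) * (real q ^ K - 1)) * (real q - 1)
      = (real q ^ (p * K) - 1) * real (card C) * (real (card I) * (real q ^ K - 1))"
    using * by (simp add: mult_ac)
  also have "\<dots> = ((real q ^ (p * K) - 1) * real (card C)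
      * (real q ^ K * (real q ^ ((ell + 1) * K) - 1))) * (real q - 1)"
    unfolding card_I by (simp only: mult_ac)
  finally have "real (card (lift C)) * (real q ^ K - 1)
      = (real q ^ (p * K) - 1) * real (card C) * (real q ^ K * (real q ^ ((ell + 1) * K) - 1))"
    using q by simp
  then show ?thesis using q by (simp add: field_simps)
qed

lemma lift_nonempty: "C \<noteq> {} \<Longrightarrow> lift C \<noteq> {}"
proof -
  assume "C \<noteq> {}"
  \<comment> \<open>This is the index of the map \<open>u + u ^ q * g\<close>.\<close>
  moreover have "(0, [], 0, 0, 0) \<in> I" by (simp add: Idx_def)
  moreover have "1 \<in> GF q (p * K) - {0::'a}" by simp
  ultimately show ?thesis unfolding lift_def by blast
qed

end
end
end

section \<open>The tower of levels and the final assembly\<close>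

lemma Dseq_0:
  assumes "code_level q n p k (w 1) (g 1 :: 'a::{field,finite})"
  shows "Dseq q p k w g 0 = code_level.lift q p k (w 1) (g 1) {GF q k}"
  unfolding code_level.lift_def[OF assms] Dseq.simps levelA_def Orb_def by blast

lemma Dseq_Suc:
  assumes "code_level q n p (p ^ (m + 1) * k) (w (m + 2)) (g (m + 2) :: 'a::{field,finite})"
  shows "Dseq q p k w g (Suc m) =
    code_level.lift q p (p ^ (m + 1) * k) (w (m + 2)) (g (m + 2)) (Dseq q p k w g m)"
  unfolding code_level.lift_def[OF assms] by simp

text \<open>Both cases are the same lifting step once \<open>{GF q k}\<close> is taken as the level before the first.\<close>
definition code_before :: "nat \<Rightarrow> nat \<Rightarrow> nat \<Rightarrow> (nat \<Rightarrow> 'a::{field,finite}) \<Rightarrow> (nat \<Rightarrow> 'a) \<Rightarrow> nat \<Rightarrow> 'a set set" where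
  "code_before q p k w g m = (case m of 0 \<Rightarrow> {GF q k} | Suc m' \<Rightarrow> Dseq q p k w g m')"

lemma code_before_Suc:
  assumes "code_level q n p (p ^ m * k) (w (Suc m)) (g (Suc m) :: 'a::{field,finite})"
  shows "code_before q p k w g (Suc m) =
    code_level.lift q p (p ^ m * k) (w (Suc m)) (g (Suc m)) (code_before q p k w g m)"
proof (cases m)
  case 0
  then show ?thesis using Dseq_0[of q n p k w g] assms by (simp add: code_before_def)
next
  case (Suc m')
  then show ?thesis using Dseq_Suc[of q n p m' k w g] assms by (simp add: code_before_def)
qed

theorem theorem3p10:
  fixes q p e k :: nat and w g :: "nat \<Rightarrow> 'a::{field,finite}"
  assumes "\<exists>r m. prime r \<and> m \<ge> 1 \<and> q = r ^ m"
    and "prime p" and "odd p" and "e \<ge> 1" and "k \<ge> 2"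
    and "card (UNIV :: 'a set) = q ^ (p ^ e * k)"
    and "\<forall>i\<in>{1..e}. primitive_elem q (p ^ (i - 1) * k) (w i)"
    and "\<forall>i\<in>{1..e}. g i \<in> GF q (p * (p ^ (i - 1) * k))
                   \<and> adjoin (GF q (p ^ (i - 1) * k)) (g i) = GF q (p * (p ^ (i - 1) * k))"
  shows "multi_orbit_cyclic q (p ^ e * k) k (Dseq q p k w g (e - 1))
    \<and> real (card (Dseq q p k w g (e - 1))) =
        (\<Prod>i=1..e. real q ^ (p ^ (i - 1) * k) * (real q ^ (((p - 3) div 2 + 1) * p ^ (i - 1) * k) - 1)
                    * (real q ^ (p ^ i * k) - 1) / (real q ^ (p ^ (i - 1) * k) - 1))
    \<and> min_dist q (Dseq q p k w g (e - 1)) = 2 * k - 2"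
proof -
  define n where "n = p ^ e * k"
  have "p > 0" using assms(2) by (rule prime_gt_0_nat)
  have "p \<ge> 3" using prime_ge_2_nat[OF assms(2)] assms(3) by (cases "p = 2") auto
  interpret finite_field_tower q n "TYPE('a)"
    using assms(1,5,6) \<open>p > 0\<close> by unfold_locales (auto simp: n_def)
  have level: "code_level q n p (p ^ m * k) (w (Suc m)) (g (Suc m))" if "m < e" for m
  proof unfold_locales
    have "p ^ Suc m * k dvd n"
      unfolding n_def using that by (intro mult_dvd_mono le_imp_power_dvd) auto
    then show "p * (p ^ m * k) dvd n" by (simp add: mult.assoc)
    have "Suc m \<in> {1..e}" using that by simp
    then show "primitive_elem q (p ^ m * k) (w (Suc m))" "g (Suc m) \<in> GF q (p * (p ^ m * k))"
      "adjoin (GF q (p ^ m * k)) (g (Suc m)) = GF q (p * (p ^ m * k))"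
      using assms(7,8) by fastforce+
  qed (use assms(3) \<open>p \<ge> 3\<close> in auto)
  let ?C = "code_before q p k w g"
  let ?N = "\<lambda>i. real q ^ (p ^ (i - 1) * k) * (real q ^ (((p - 3) div 2 + 1) * p ^ (i - 1) * k) - 1)
                    * (real q ^ (p ^ i * k) - 1) / (real q ^ (p ^ (i - 1) * k) - 1)"
  \<comment> \<open>Induction over the levels, starting from the single codeword
    \<open>GF q k\<close> and the empty product.\<close>
  have codes: "sparse_code (p ^ m * k) k (?C m) \<and> ?C m \<noteq> {} \<and> real (card (?C m)) = (\<Prod>i=1..m. ?N i)"
    if "m \<le> e" for m
    using that
  proof (induction m)
    case 0
    have "k dvd n" by (simp add: n_def)
    then show ?case
      using Fsubspace_GF[of k] card_GF[of k] by (simp add: code_before_def sparse_code_def)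
  next
    case (Suc m)
    interpret code_level q n "TYPE('a)" p "p ^ m * k" "w (Suc m)" "g (Suc m)"
      by (rule level) (use Suc.prems in simp)
    have IH: "sparse_code (p ^ m * k) k (?C m)" "?C m \<noteq> {}" "real (card (?C m)) = (\<Prod>i=1..m. ?N i)"
      using Suc by auto
    have C: "?C (Suc m) = lift (?C m)"
      by (intro code_before_Suc[of q n] level) (use Suc.prems in simp)
    have "real (card (?C (Suc m))) = (\<Prod>i=1..m. ?N i) * ?N (Suc m)"
      unfolding C card_lift[OF IH(1) assms(5)] IH(3) by (simp add: mult.assoc)
    then show ?case
      using sparse_code_lift[OF IH(1) assms(5)] lift_nonempty[OF IH(1) assms(5) IH(2)]
      by (simp add: C mult.assoc)
  qed
  obtain m where m: "e = Suc m" using assms(4) by (cases e) auto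
  interpret code_level q n "TYPE('a)" p "p ^ m * k" "w (Suc m)" "g (Suc m)"
    by (rule level) (simp add: m)
  have D: "Dseq q p k w g (e - 1) = ?C e" by (simp add: m code_before_def)
  have C: "?C e = lift (?C m)"
    unfolding m by (intro code_before_Suc[of q n] level) (simp add: m)
  have sparse: "sparse_code (p ^ m * k) k (?C m)" using codes[of m] m by simp
  \<comment> \<open>At the last level the scalars run through all nonzero elements of the ambient
    field, as the orbit and distance lemmas require.\<close>
  have top: "GF q (p * (p ^ m * k)) = (UNIV :: 'a set)"
    using GF_n by (simp add: n_def m mult.assoc)
  have closed: "smul b U \<in> ?C e" if "U \<in> ?C e" "b \<noteq> 0" for U b
    using lift_smul_closed[OF sparse assms(5)] that by (simp add: C top)
  have stab: "b \<in> Fq" if "U \<in> ?C e" "b \<noteq> 0" "smul b U = U" for U b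
    using lift_stabilizer[OF sparse assms(5)] that by (simp add: C)
  have e: "sparse_code n k (?C e)" "?C e \<noteq> {}" "real (card (?C e)) = (\<Prod>i=1..e. ?N i)"
    using codes[of e] by (simp_all add: n_def)
  show ?thesis
    unfolding D n_def[symmetric]
    by (intro conjI e(3) sparse_code_multi_orbit_cyclic[OF e(1)]
        sparse_code_min_dist[OF e(1) assms(5) e(2)] closed stab)
qed

end
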